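(* Let $n \ge 2$ be an integer, let $m \ge 2$ be an even integer, and let $B_1 \subset \mathbb{R}^n$ be the open unit ball centered at zero. Let $g : (0, \infty) \to (0, \infty)$ be a non-decreasing continuous function such that $$\int_1^\infty g^{-1/m}(\zeta)\, \zeta^{1/m - 1}\, d\zeta = \infty.$$ Then for any $f \in L_{loc, \infty}(\overline{B_1} \setminus \{0\})$ the inequality $$\Delta^{m/2} u \ge f(x)\, g(u) \quad \text{in } B_1 \setminus \{0\}$$ has a positive solution with a non-removable singularity at zero.
   Context: $B_r$ denotes the open ball in $\mathbb{R}^n$ of radius $r > 0$ centered at zero. The space $L_{loc,\infty}(\overline{B_1} \setminus \{0\})$ consists of measurable real-valued functions that are essentially bounded on $B_1 \setminus B_r$ for every $r \in (0,1)$; similarly, $L_{loc,1}(\overline{B_1} \setminus \{0\})$ consists of measurable functions that are integrable on $B_1 \setminus B_r$ for every $r \in (0,1)$. A positive function $u$ is a solution of $\Delta^{m/2} u \ge f(x) g(u)$ in $B_1 \setminus \{0\}$ if $u \in L_{loc,1}(\overline{B_1} \setminus \{0\})$, $f(x) g(u) \in L_{loc,1}(\overline{B_1} \setminus \{0\})$, and $$\int_{B_1} u\, \Delta^{m/2} \varphi \, dx \ge \int_{B_1} f(x)\, g(u)\, \varphi \, dx \qquad ( * )$$ for all non-negative functions $\varphi \in C_0^\infty(B_1 \setminus \{0\})$. Such a solution $u$ has a removable singularity at zero if $u \in L_1(B_1)$, $f(x) g(u) \in L_1(B_1)$, and inequality $( * )$ is valid for all non-negative functions $\varphi \in C_0^\infty(B_1)$.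 Otherwise the singularity of $u$ at zero is called non-removable. *)

theory Defs
  imports "HOL-Analysis.Analysis"
begin

text \<open>A real-valued function on the whole space is of class C^0 if it is continuous, and of class
  C^(k+1) if it is differentiable everywhere and all its first-order partial derivatives are of
  class C^k.\<close>

primrec Ck :: "nat \<Rightarrow> ('a::euclidean_space \<Rightarrow> real) \<Rightarrow> bool" where
  "Ck 0 \<phi> \<longleftrightarrow> continuous_on UNIV \<phi>"
| "Ck (Suc k) \<phi> \<longleftrightarrow> (\<forall>x. \<phi> differentiable (at x)) \<and>
     (\<forall>b\<in>Basis. Ck k (\<lambda>x. frechet_derivative \<phi> (at x) b))"

text \<open>The space of test functions on \<open>\<Omega>\<close>. Elements are represented by their extension by zero
  to the whole space.\<close>

definition test_functions :: "'a::euclidean_space set \<Rightarrow> ('a \<Rightarrow> real) set" where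
  "test_functions \<Omega> = {\<phi>. (\<forall>k. Ck k \<phi>) \<and>
     compact (closure (support_on UNIV \<phi>)) \<and> closure (support_on UNIV \<phi>) \<subseteq> \<Omega>}"

definition laplacian :: "('a::euclidean_space \<Rightarrow> real) \<Rightarrow> 'a \<Rightarrow> real" where
  "laplacian \<phi> x =
     (\<Sum>b\<in>Basis. frechet_derivative (\<lambda>y. frechet_derivative \<phi> (at y) b) (at x) b)"

definition Lloc_infinity :: "('a::euclidean_space \<Rightarrow> real) set" where
  "Lloc_infinity = {f. f \<in> borel_measurable (lebesgue_on (ball 0 1 - {0})) \<and>
     (\<forall>r\<in>{0<..<1}. \<exists>C. AE x in lebesgue_on (ball 0 1 - ball 0 r). \<bar>f x\<bar> \<le> C)}"

definition Lloc_1 :: "('a::euclidean_space \<Rightarrow> real) set" where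
  "Lloc_1 = {f. f \<in> borel_measurable (lebesgue_on (ball 0 1 - {0})) \<and>
     (\<forall>r\<in>{0<..<1}. f absolutely_integrable_on (ball 0 1 - ball 0 r))}"

text \<open>The integral inequality, tested against all non-negative test functions on \<open>\<Omega>\<close>. The
  operator is the power \<open>m / 2\<close> of the Laplacian, with \<open>m\<close> even. Bochner integrals
  of non-integrable functions are 0 by convention; below, the inequality is always combined with
  integrability assumptions that make both integrands integrable.\<close>

definition weak_inequality ::
  "'a::euclidean_space set \<Rightarrow> nat \<Rightarrow> ('a \<Rightarrow> real) \<Rightarrow> (real \<Rightarrow> real) \<Rightarrow> ('a \<Rightarrow> real) \<Rightarrow> bool" where
  "weak_inequality \<Omega> m f g u \<longleftrightarrow>
     (\<forall>\<phi>\<in>test_functions \<Omega>. (\<forall>x. \<phi> x \<ge> 0) \<longrightarrow>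
        (LINT x:ball 0 1|lebesgue. u x * (laplacian ^^ (m div 2)) \<phi> x)
          \<ge> (LINT x:ball 0 1|lebesgue. f x * g (u x) * \<phi> x))"

text \<open>The value of \<open>u\<close> at the origin, a null set, is irrelevant.\<close>

definition positive_solution ::
  "nat \<Rightarrow> ('a::euclidean_space \<Rightarrow> real) \<Rightarrow> (real \<Rightarrow> real) \<Rightarrow> ('a \<Rightarrow> real) \<Rightarrow> bool" where
  "positive_solution m f g u \<longleftrightarrow>
     (\<forall>x\<in>ball 0 1 - {0}. u x > 0) \<and>
     u \<in> Lloc_1 \<and> (\<lambda>x. f x * g (u x)) \<in> Lloc_1 \<and>
     weak_inequality (ball 0 1 - {0}) m f g u"

definition removable_singularity ::
  "nat \<Rightarrow> ('a::euclidean_space \<Rightarrow> real) \<Rightarrow> (real \<Rightarrow> real) \<Rightarrow> ('a \<Rightarrow> real) \<Rightarrow> bool" where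
  "removable_singularity m f g u \<longleftrightarrow>
     u absolutely_integrable_on ball 0 1 \<and>
     (\<lambda>x. f x * g (u x)) absolutely_integrable_on ball 0 1 \<and>
     weak_inequality (ball 0 1) m f g u"

end

theory Submission
  imports Defs
begin

text \<open>
  The solution is radial. Put $\rho = 1/|x|$, let $n$ be the dimension and look for
  $u = \rho^{n+1} G(\rho)$ with a function $G \ge 1$ on $[0,\infty)$ all of whose derivatives up to
  order $m$ are non-negative. Such a $u$ is at least $|x|^{-n-1}$ near the origin, hence it is not
  integrable and its singularity is not removable
  (\<open>inverse_norm_power_not_integrable\<close>).

  The weight $\rho^{n+1}$ also makes the iterated Laplacian easy to bound from below. Applied to
  $\rho^a G^{(i)}(\rho)$ with $a > n$, the Laplacian produces a combination of functions of the same
  form with non-negative coefficients, with leading summand $\rho^{a+4} G^{(i+2)}(\rho)$. Keeping only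
  this summand in each step gives $\Delta^{m/2} u \ge \rho^{n+1+2m} G^{(m)}(\rho) \ge G^{(m)}(\rho)$
  in the unit ball, where $\rho \ge 1$ (\<open>radial_iterated_laplacian\<close>, in weak form). If $H$ is a
  continuous non-decreasing function with $|f| \le H(\rho)$ almost everywhere, it remains to solve
  \[ G^{(m)}(t) = H(t) \, g(t^{n+1} G(t)) \quad (t \ge 0) . \]

  That no solution of this equation blows up in finite time is what the divergent integral says.
  Solutions that start with vanishing higher derivatives satisfy
  $G' \le C \, (G^{(m)})^{1/m} G^{1-1/m}$, a consequence of the monotonicity of all derivatives
  (\<open>iterated_primitive_interpolation\<close>), and this turns the equation of order $m$ into a first-order
  inequality to which Osgood's argument applies (\<open>iteration_bound\<close>). The bound holds for all the
  successive approximations, which increase because $g$ does, and so they converge to a solution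
  (\<open>global_solution\<close>). Monotone iteration is used because $g$ is only continuous, so that there is
  no contraction.
\<close>

section \<open>Test functions and their partial derivatives\<close>

lemma Ck_zero: "Ck k (\<lambda>_. 0)"
  by (induction k) auto

lemma Ck_add: "Ck k \<phi> \<Longrightarrow> Ck k \<psi> \<Longrightarrow> Ck k (\<lambda>x. \<phi> x + \<psi> x)"
proof (induction k arbitrary: \<phi> \<psi>)
  case (Suc k)
  have "frechet_derivative (\<lambda>y. \<phi> y + \<psi> y) (at x) =
      (\<lambda>b. frechet_derivative \<phi> (at x) b + frechet_derivative \<psi> (at x) b)" for x
    using Suc.prems
    by (intro frechet_derivative_at[symmetric] has_derivative_add) (auto simp: frechet_derivative_works)
  then show ?case using Suc by (auto intro: differentiable_add)
qed (auto intro: continuous_on_add)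

lemma Ck_sum: "finite B \<Longrightarrow> (\<And>b. b \<in> B \<Longrightarrow> Ck k (\<phi> b)) \<Longrightarrow> Ck k (\<lambda>x. \<Sum>b\<in>B. \<phi> b x)"
  by (induction B rule: finite_induct) (auto intro: Ck_zero Ck_add)

lemma test_functionsI:
  assumes "\<And>k. Ck k \<phi>" "compact S" "S \<subseteq> \<Omega>" "\<And>x. x \<notin> S \<Longrightarrow> \<phi> x = 0"
  shows "\<phi> \<in> test_functions \<Omega>"
proof -
  have *: "closure (support_on UNIV \<phi>) \<subseteq> S"
    using assms by (intro closure_minimal compact_imp_closed) (auto simp: support_on_def)
  then have "compact (closure (support_on UNIV \<phi>))"
    using assms(2) by (meson closed_closure compact_closure bounded_subset compact_imp_bounded closure_subset)
  then show ?thesis using assms * by (auto simp: test_functions_def)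
qed

lemma test_functionsE:
  assumes "\<phi> \<in> test_functions \<Omega>"
  obtains S where "\<And>k. Ck k \<phi>" "compact S" "S \<subseteq> \<Omega>" "\<And>x. x \<notin> S \<Longrightarrow> \<phi> x = 0"
proof
  show "\<phi> x = 0" if "x \<notin> closure (support_on UNIV \<phi>)" for x
    using that closure_subset[of "support_on UNIV \<phi>"] by (auto simp: support_on_def)
qed (use assms in \<open>auto simp: test_functions_def\<close>)

definition partial :: "'a::euclidean_space \<Rightarrow> ('a \<Rightarrow> real) \<Rightarrow> 'a \<Rightarrow> real" where
  "partial b \<phi> x = frechet_derivative \<phi> (at x) b"

lemma test_functions_partial:
  assumes "\<phi> \<in> test_functions \<Omega>" "b \<in> Basis"
  shows "partial b \<phi> \<in> test_functions \<Omega>"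
proof -
  obtain S where S: "\<And>k. Ck k \<phi>" "compact S" "S \<subseteq> \<Omega>" "\<And>x. x \<notin> S \<Longrightarrow> \<phi> x = 0"
    using test_functionsE[OF assms(1)] by metis
  show ?thesis
  proof (rule test_functionsI[OF _ S(2,3)])
    show "Ck k (partial b \<phi>)" for k
      using S(1)[of "Suc k"] assms(2) by (simp add: partial_def[abs_def])
    show "partial b \<phi> x = 0" if "x \<notin> S" for x
    proof -
      have "(\<phi> has_derivative (\<lambda>_. 0)) (at x)"
        by (rule has_derivative_transform_within_open[where f = "\<lambda>_. 0" and s = "- S"])
          (use S that in \<open>auto simp: compact_imp_closed open_Compl\<close>)
      then show ?thesis unfolding partial_def by (metis frechet_derivative_at)
    qed
  qed
qed

lemma laplacian_eq: "laplacian \<phi> = (\<lambda>x. \<Sum>b\<in>Basis. partial b (partial b \<phi>) x)"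
  by (simp add: laplacian_def[abs_def] partial_def[abs_def])

lemma test_functions_sum:
  assumes "finite B" "\<And>b. b \<in> B \<Longrightarrow> \<phi> b \<in> test_functions \<Omega>"
  shows "(\<lambda>x. \<Sum>b\<in>B. \<phi> b x) \<in> test_functions \<Omega>"
proof -
  have "\<forall>b\<in>B. \<exists>S. compact S \<and> S \<subseteq> \<Omega> \<and> (\<forall>x. x \<notin> S \<longrightarrow> \<phi> b x = 0)"
    using assms(2) by (meson test_functionsE)
  then obtain S where S: "\<And>b. b \<in> B \<Longrightarrow> compact (S b) \<and> S b \<subseteq> \<Omega> \<and> (\<forall>x. x \<notin> S b \<longrightarrow> \<phi> b x = 0)"
    by metis
  show ?thesis
  proof (rule test_functionsI[where S = "\<Union>b\<in>B. S b"])
    show "Ck k (\<lambda>x. \<Sum>b\<in>B. \<phi> b x)" for k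
      using assms by (intro Ck_sum) (auto simp: test_functions_def)
    show "compact (\<Union>b\<in>B. S b)" using S assms(1) by (intro compact_UN) auto
  qed (use S in \<open>auto intro!: sum.neutral\<close>)
qed

lemma test_functions_laplacian:
  "\<phi> \<in> test_functions \<Omega> \<Longrightarrow> laplacian \<phi> \<in> test_functions \<Omega>"
  unfolding laplacian_eq by (intro test_functions_sum test_functions_partial) auto

lemma test_function_continuous: "\<phi> \<in> test_functions \<Omega> \<Longrightarrow> continuous_on UNIV \<phi>"
  unfolding test_functions_def using Ck.simps(1) by blast

lemma test_function_has_partial:
  assumes "\<phi> \<in> test_functions \<Omega>"
  shows "((\<lambda>t. \<phi> (x + t *\<^sub>R b)) has_real_derivative partial b \<phi> x) (at 0)"
proof -
  have "Ck (Suc 0) \<phi>" using assms by (simp only: test_functions_def) blast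
  then have "(\<phi> has_derivative frechet_derivative \<phi> (at x)) (at x)"
    by (auto simp: frechet_derivative_works)
  then have d: "(\<phi> has_derivative frechet_derivative \<phi> (at x)) (at (x + 0 *\<^sub>R b))" by simp
  have "((\<lambda>t. \<phi> (x + t *\<^sub>R b)) has_derivative (\<lambda>t. frechet_derivative \<phi> (at x) (0 + t *\<^sub>R b))) (at 0)"
    by (rule has_derivative_compose[where f = "\<lambda>t. x + t *\<^sub>R b", OF _ d]) (auto intro!: derivative_eq_intros)
  moreover have "linear (frechet_derivative \<phi> (at x))"
    using d by (simp add: has_derivative_linear)
  ultimately show ?thesis
    by (simp add: has_field_derivative_def partial_def linear_cmul mult.commute[of _ "frechet_derivative _ _ _"])
qed

section \<open>Green's formula for radial functions\<close>

lemma integrable_continuous_compact_support: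
  fixes F :: "'a::euclidean_space \<Rightarrow> real"
  assumes "continuous_on UNIV F" "compact S" "\<And>x. x \<notin> S \<Longrightarrow> F x = 0"
  shows "integrable lborel F"
proof -
  have "integrable lborel (\<lambda>x. indicator S x *\<^sub>R F x)"
    by (rule borel_integrable_compact[OF assms(2)]) (rule continuous_on_subset[OF assms(1)], simp)
  moreover have "(\<lambda>x. indicator S x *\<^sub>R F x) = F" using assms(3) by (auto simp: indicator_def fun_eq_iff)
  ultimately show ?thesis by simp
qed

text \<open>Difference quotients of an integrable function in a fixed direction have integral zero, because
  Lebesgue measure is translation invariant; the mean value theorem bounds them uniformly, so
  dominated convergence carries this over to the derivative. This replaces integration by parts.\<close>

lemma integral_directional_derivative_eq_0:
  fixes F D :: "'a::euclidean_space \<Rightarrow> real"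
  assumes deriv: "\<And>x. ((\<lambda>t. F (x + t *\<^sub>R b)) has_real_derivative D x) (at 0)"
    and F: "continuous_on UNIV F" and D: "continuous_on UNIV D"
    and S: "compact S" "\<And>x. x \<notin> S \<Longrightarrow> F x = 0" "\<And>x. x \<notin> S \<Longrightarrow> D x = 0"
  shows "integral\<^sup>L lborel D = 0"
proof -
  have deriv': "((\<lambda>t. F (x + t *\<^sub>R b)) has_real_derivative D (x + t *\<^sub>R b)) (at t)" for x t
  proof -
    have "((\<lambda>s. F ((x + t *\<^sub>R b) + s *\<^sub>R b)) has_real_derivative D (x + t *\<^sub>R b)) (at 0)" by (rule deriv)
    then have "((\<lambda>s. F (x + (s + t) *\<^sub>R b)) has_real_derivative D (x + t *\<^sub>R b)) (at 0)"
      by (simp add: algebra_simps)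
    then show ?thesis using DERIV_shift[of "\<lambda>s. F (x + s *\<^sub>R b)" "D (x + t *\<^sub>R b)" 0 t] by simp
  qed
  have "bounded (D ` S)" using S(1) D by (meson compact_continuous_image compact_imp_bounded continuous_on_subset subset_UNIV)
  then obtain M0 where "\<And>x. x \<in> S \<Longrightarrow> \<bar>D x\<bar> \<le> M0" by (auto simp: bounded_iff)
  then have M: "\<bar>D x\<bar> \<le> max 0 M0" for x using S(3)[of x] by (cases "x \<in> S") force+
  define M where "M = max 0 M0"
  obtain R where R: "\<And>x. x \<in> S \<Longrightarrow> norm x \<le> R" using compact_imp_bounded[OF S(1)] by (auto simp: bounded_iff)
  define h where "h n = inverse (real (Suc n))" for n
  have h: "0 < h n" "h n \<le> 1" for n by (auto simp: h_def inverse_le_1_iff)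
  have h0: "h \<longlonglongrightarrow> 0" unfolding h_def by (rule LIMSEQ_inverse_real_of_nat)
  define q where "q n x = (F (x + h n *\<^sub>R b) - F x) / h n" for n x
  have Fi: "integrable lborel F" by (rule integrable_continuous_compact_support[OF F S(1,2)])
  have trans: "integrable lborel (\<lambda>x. F (x + c))" "(\<integral>x. F (x + c) \<partial>lborel) = integral\<^sup>L lborel F" for c
  proof -
    have d: "distr lborel borel (\<lambda>x. x + c) = lborel"
    proof -
      have "(\<lambda>x. x + c) = (+) c" by (auto simp: add.commute)
      then show ?thesis by (simp add: lborel_distr_plus)
    qed
    have m: "F \<in> borel_measurable borel" by (rule borel_measurable_continuous_onI[OF F])
    show "integrable lborel (\<lambda>x. F (x + c))"
      using integrable_distr_eq[of "\<lambda>x. x + c" lborel borel F] Fi d m by simp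
    show "(\<integral>x. F (x + c) \<partial>lborel) = integral\<^sup>L lborel F"
      using integral_distr[of "\<lambda>x. x + c" lborel borel F] d m by simp
  qed
  have q_int: "integrable lborel (q n)" "integral\<^sup>L lborel (q n) = 0" for n
    unfolding q_def using trans[of "h n *\<^sub>R b"] Fi by auto
  have "(\<lambda>n. integral\<^sup>L lborel (q n)) \<longlonglongrightarrow> integral\<^sup>L lborel D"
  proof (rule integral_dominated_convergence[where w = "\<lambda>x. M * indicator (cball 0 (R + norm b)) x"])
    show "integrable lborel (\<lambda>x. M * indicator (cball 0 (R + norm b)) x :: real)"
      using emeasure_lborel_cball_finite[of 0 "R + norm b"]
      by (intro integrable_mult_right integrable_real_indicator) auto
    show "D \<in> borel_measurable lborel" using borel_measurable_continuous_onI[OF D] by simp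
    show "AE x in lborel. (\<lambda>n. q n x) \<longlonglongrightarrow> D x"
    proof (rule AE_I2)
      fix x
      have "((\<lambda>t. (F (x + t *\<^sub>R b) - F x) / t) \<longlongrightarrow> D x) (at 0)"
        using deriv[of x] by (simp add: has_field_derivative_iff)
      moreover have "filterlim h (at 0) sequentially"
        using h0 h(1) by (auto simp: filterlim_at less_imp_neq[symmetric])
      ultimately show "(\<lambda>n. q n x) \<longlonglongrightarrow> D x"
        unfolding q_def by (rule filterlim_compose)
    qed
    show "AE x in lborel. norm (q n x) \<le> M * indicator (cball 0 (R + norm b)) x" for n
    proof (rule AE_I2)
      fix x
      show "norm (q n x) \<le> M * indicator (cball 0 (R + norm b)) x"
      proof (cases "norm x \<le> R + norm b")
        case True
        obtain z where "F (x + h n *\<^sub>R b) - F (x + 0 *\<^sub>R b) = (h n - 0) * D (x + z *\<^sub>R b)"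
          using MVT2[of 0 "h n" "\<lambda>t. F (x + t *\<^sub>R b)" "\<lambda>t. D (x + t *\<^sub>R b)"] deriv' h by blast
        then have "q n x = D (x + z *\<^sub>R b)" unfolding q_def using h(1)[of n] by simp
        then show ?thesis using M True by (simp add: M_def)
      next
        case False
        have "norm (h n *\<^sub>R b) \<le> norm b" using h[of n] by (simp add: mult_left_le_one_le)
        moreover have "norm x \<le> norm (x + h n *\<^sub>R b) + norm (h n *\<^sub>R b)"
          using norm_triangle_ineq4[of "x + h n *\<^sub>R b" "h n *\<^sub>R b"] by (simp only: add_diff_cancel_right')
        moreover have "R + norm b < norm x" using False by simp
        ultimately have "R < norm (x + h n *\<^sub>R b)" "R < norm x"
          using norm_ge_zero[of b] by linarith+
        then have "F (x + h n *\<^sub>R b) = 0" "F x = 0" using R S(2) by (meson not_less)+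
        then show ?thesis by (simp add: q_def M_def)
      qed
    qed
  qed (use q_int in auto)
  then show ?thesis using q_int by (simp add: LIMSEQ_const_iff)
qed

text \<open>The solution is continuous only away from the origin, but a test function vanishes near it, so
  that the product of the two is an honest continuous function with compact support.\<close>

lemma test_function_product:
  fixes w :: "'a::euclidean_space \<Rightarrow> real"
  assumes "continuous_on (- {0}) w" "\<phi> \<in> test_functions \<Omega>" "0 \<notin> \<Omega>"
  shows "continuous_on UNIV (\<lambda>x. w x * \<phi> x)" "integrable lborel (\<lambda>x. w x * \<phi> x)"
proof -
  obtain S where S: "compact S" "S \<subseteq> \<Omega>" "\<And>x. x \<notin> S \<Longrightarrow> \<phi> x = 0"
    using test_functionsE[OF assms(2)] by metis
  have op: "open (- S)" using S(1) by (simp add: compact_imp_closed open_Compl)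
  have "continuous_on (- {0}) (\<lambda>x. w x * \<phi> x)"
    by (intro continuous_on_mult assms(1) continuous_on_subset[OF test_function_continuous[OF assms(2)]]) auto
  moreover have "continuous_on (- S) (\<lambda>x. w x * \<phi> x)"
    using continuous_on_cong[of "- S" "- S" "\<lambda>x. w x * \<phi> x" "\<lambda>_. 0"] S(3) by auto
  ultimately have "continuous_on (- {0} \<union> - S) (\<lambda>x. w x * \<phi> x)"
    by (intro continuous_on_open_Un op) auto
  moreover have "- {0} \<union> - S = UNIV" using S(2) assms(3) by auto
  ultimately show c: "continuous_on UNIV (\<lambda>x. w x * \<phi> x)" by simp
  show "integrable lborel (\<lambda>x. w x * \<phi> x)"
    by (rule integrable_continuous_compact_support[OF c S(1)]) (use S(3) in auto)
qed

lemma has_partial_inverse_norm: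
  fixes x :: "'a::euclidean_space"
  assumes "x \<noteq> 0"
  shows "((\<lambda>t. inverse (norm (x + t *\<^sub>R b))) has_real_derivative - (inverse (norm x) ^ 3 * (x \<bullet> b))) (at 0)"
proof -
  have "((\<lambda>t. norm (x + t *\<^sub>R b)) has_derivative (\<lambda>t. t * (sgn x \<bullet> b))) (at 0)"
  proof -
    have "((\<lambda>t. x + t *\<^sub>R b) has_derivative (\<lambda>t. t *\<^sub>R b)) (at 0)"
      by (auto intro!: derivative_eq_intros)
    from has_derivative_compose[OF this, of norm "\<lambda>h. h \<bullet> sgn x"] show ?thesis
      using has_derivative_norm[OF assms] by (simp add: inner_commute)
  qed
  then have "((\<lambda>t. norm (x + t *\<^sub>R b)) has_real_derivative sgn x \<bullet> b) (at 0)"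
    by (simp add: has_field_derivative_def mult.commute[of _ "sgn x \<bullet> b"])
  from DERIV_inverse'[OF this] show ?thesis
    using assms by (simp add: sgn_div_norm power3_eq_cube divide_simps)
qed

text \<open>For $w = q_0(\rho)$ with $\rho = 1/|x|$ the function $w \, \Delta \varphi - \Delta w \, \varphi$
  is the sum over the basis vectors $b$ of the $b$-derivatives of
  $w \, \partial_b \varphi - \partial_b w \, \varphi$, and these have integral zero. The factor on the
  right is the radial Laplacian $\Delta w = \rho^4 q_0'' + (3-n) \rho^3 q_0'$ in dimension $n$.\<close>

lemma radial_Green:
  fixes q0 q1 q2 :: "real \<Rightarrow> real" and \<phi> \<rho> :: "'a::euclidean_space \<Rightarrow> real"
  defines "\<rho> \<equiv> \<lambda>x. inverse (norm x)"
  assumes d0: "\<And>t. 0 < t \<Longrightarrow> (q0 has_real_derivative q1 t) (at t)"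
    and d1: "\<And>t. 0 < t \<Longrightarrow> (q1 has_real_derivative q2 t) (at t)"
    and q2: "continuous_on {0<..} q2"
    and \<phi>: "\<phi> \<in> test_functions \<Omega>" "0 \<notin> \<Omega>"
  shows "(\<integral>x. q0 (\<rho> x) * laplacian \<phi> x \<partial>lborel) =
    (\<integral>x. (\<rho> x ^ 4 * q2 (\<rho> x) + (3 - real DIM('a)) * \<rho> x ^ 3 * q1 (\<rho> x)) * \<phi> x \<partial>lborel)"
proof -
  obtain S where Ck: "\<And>k. Ck k \<phi>" and S: "compact S" "S \<subseteq> \<Omega>" "\<And>x. x \<notin> S \<Longrightarrow> \<phi> x = 0"
    using test_functionsE[OF \<phi>(1)] by metis
  have S0: "0 \<notin> S" using S(2) \<phi>(2) by blast
  have \<phi>S: "\<phi> \<in> test_functions S" by (rule test_functionsI[OF Ck S(1) order_refl S(3)])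
  have pos: "0 < \<rho> x" if "x \<noteq> 0" for x using that by (simp add: \<rho>_def)
  have \<rho>_cont: "continuous_on (- {0}) \<rho>" unfolding \<rho>_def by (intro continuous_intros) auto
  have comp: "continuous_on (- {0}) (\<lambda>x. q (\<rho> x))" if "continuous_on {0<..} q" for q :: "real \<Rightarrow> real"
    by (rule continuous_on_compose2[OF that \<rho>_cont]) (use pos in auto)
  have q0: "continuous_on {0<..} q0" and q1: "continuous_on {0<..} q1"
    by (rule DERIV_continuous_on, rule has_field_derivative_at_within, use d0 d1 in force)+
  \<comment> \<open>The first and second derivatives of $w = q_0(\rho)$ in direction \<open>b\<close>.\<close>
  define w' where "w' b x = - (\<rho> x ^ 3 * (x \<bullet> b)) * q1 (\<rho> x)" for b x
  define w'' where "w'' b x = (\<rho> x ^ 6 * q2 (\<rho> x) + 3 * \<rho> x ^ 5 * q1 (\<rho> x)) * (x \<bullet> b)\<^sup>2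
      - \<rho> x ^ 3 * q1 (\<rho> x) * (b \<bullet> b)" for b x
  have w'_cont: "continuous_on (- {0}) (w' b)" and w''_cont: "continuous_on (- {0}) (w'' b)" for b
    unfolding w'_def w''_def by (intro continuous_intros \<rho>_cont comp q1 q2)+
  have d\<rho>: "((\<lambda>t. \<rho> (x + t *\<^sub>R b)) has_real_derivative - (\<rho> x ^ 3 * (x \<bullet> b))) (at 0)" if "x \<noteq> 0" for x b
    unfolding \<rho>_def using has_partial_inverse_norm[OF that] .
  have dq: "((\<lambda>t. q (\<rho> (x + t *\<^sub>R b))) has_real_derivative q' (\<rho> x) * - (\<rho> x ^ 3 * (x \<bullet> b))) (at 0)"
    if "x \<noteq> 0" "\<And>t. 0 < t \<Longrightarrow> (q has_real_derivative q' t) (at t)" for x b and q q' :: "real \<Rightarrow> real"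
  proof (rule DERIV_chain2[OF _ d\<rho>[OF that(1)]])
    show "(q has_real_derivative q' (\<rho> x)) (at (\<rho> (x + 0 *\<^sub>R b)))" using that pos by simp
  qed
  have dw: "((\<lambda>t. q0 (\<rho> (x + t *\<^sub>R b))) has_real_derivative w' b x) (at 0)" if "x \<noteq> 0" for x b
    using dq[OF that d0, of b] by (simp add: w'_def mult_ac)
  have dw': "((\<lambda>t. w' b (x + t *\<^sub>R b)) has_real_derivative w'' b x) (at 0)" if "x \<noteq> 0" for x b
  proof -
    have di: "((\<lambda>t. (x + t *\<^sub>R b) \<bullet> b) has_real_derivative b \<bullet> b) (at 0)"
      unfolding inner_add_left inner_scaleR_left by (auto intro!: derivative_eq_intros)
    have "((\<lambda>t. w' b (x + t *\<^sub>R b)) has_real_derivative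
        - (3 * (- (\<rho> x ^ 3 * (x \<bullet> b)) * \<rho> x ^ 2) * (x \<bullet> b) + b \<bullet> b * \<rho> x ^ 3) * q1 (\<rho> x)
        + q2 (\<rho> x) * - (\<rho> x ^ 3 * (x \<bullet> b)) * - (\<rho> x ^ 3 * (x \<bullet> b))) (at 0)"
      unfolding w'_def
      using DERIV_mult[OF DERIV_minus[OF DERIV_mult[OF DERIV_power[where n = 3, OF d\<rho>[OF that, of b]] di]] dq[OF that d1]]
      by simp
    moreover have "- (3 * (- (\<rho> x ^ 3 * (x \<bullet> b)) * \<rho> x ^ 2) * (x \<bullet> b) + b \<bullet> b * \<rho> x ^ 3) * q1 (\<rho> x)
        + q2 (\<rho> x) * - (\<rho> x ^ 3 * (x \<bullet> b)) * - (\<rho> x ^ 3 * (x \<bullet> b)) = w'' b x"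
      unfolding w''_def by algebra
    ultimately show ?thesis by simp
  qed
  define D where "D b x = q0 (\<rho> x) * partial b (partial b \<phi>) x - w'' b x * \<phi> x" for b x
  have D0: "integral\<^sup>L lborel (D b) = 0" if b: "b \<in> Basis" for b
  proof (rule integral_directional_derivative_eq_0[of "\<lambda>x. q0 (\<rho> x) * partial b \<phi> x - w' b x * \<phi> x" b "D b" S])
    note \<phi>' = test_functions_partial[OF \<phi>S b] and \<phi>'' = test_functions_partial[OF test_functions_partial[OF \<phi>S b] b]
    have z: "\<psi> x = 0" if "\<psi> \<in> test_functions S" "x \<notin> S" for \<psi> x
      using that by (metis test_functionsE subsetD)
    show "continuous_on UNIV (\<lambda>x. q0 (\<rho> x) * partial b \<phi> x - w' b x * \<phi> x)" "continuous_on UNIV (D b)"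
      unfolding D_def
      by (intro continuous_on_diff test_function_product(1)[OF _ _ S0] comp q0 w'_cont w''_cont \<phi>S \<phi>' \<phi>'')+
    show "q0 (\<rho> x) * partial b \<phi> x - w' b x * \<phi> x = 0" "D b x = 0" if "x \<notin> S" for x
      using z[OF \<phi>S that] z[OF \<phi>' that] z[OF \<phi>'' that] by (simp_all add: D_def)
    show "((\<lambda>t. q0 (\<rho> (x + t *\<^sub>R b)) * partial b \<phi> (x + t *\<^sub>R b) - w' b (x + t *\<^sub>R b) * \<phi> (x + t *\<^sub>R b))
        has_real_derivative D b x) (at 0)" for x
    proof (cases "x \<in> S")
      case True
      then have "x \<noteq> 0" using S0 by auto
      from DERIV_diff[OF DERIV_mult[OF dw[OF this, of b] test_function_has_partial[OF \<phi>', of x b]]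
          DERIV_mult[OF dw'[OF this, of b] test_function_has_partial[OF \<phi>S, of x b]]]
      show ?thesis by (simp add: D_def algebra_simps)
    next
      case False
      have "open ((\<lambda>t. x + t *\<^sub>R b) -` (- S))"
        using S(1) by (intro open_vimage continuous_intros) (simp add: compact_imp_closed open_Compl)
      moreover have "0 \<in> (\<lambda>t. x + t *\<^sub>R b) -` (- S)" using False by simp
      moreover have "((\<lambda>_. 0) has_real_derivative D b x) (at 0)"
        using z[OF \<phi>S False] z[OF \<phi>'' False] by (simp add: D_def)
      ultimately show ?thesis
        using z[OF \<phi>S] z[OF \<phi>']
        by (elim has_field_derivative_transform_within_open) auto
    qed
  qed (rule S(1))
  have i1: "integrable lborel (\<lambda>x. q0 (\<rho> x) * partial b (partial b \<phi>) x)" if "b \<in> Basis" for b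
    by (rule test_function_product(2)[OF comp[OF q0] test_functions_partial[OF test_functions_partial[OF \<phi>(1) that] that] \<phi>(2)])
  have i2: "integrable lborel (\<lambda>x. w'' b x * \<phi> x)" for b
    by (rule test_function_product(2)[OF w''_cont \<phi>])
  have eq: "(\<integral>x. q0 (\<rho> x) * partial b (partial b \<phi>) x \<partial>lborel) = (\<integral>x. w'' b x * \<phi> x \<partial>lborel)"
    if "b \<in> Basis" for b
    using D0[OF that] i1[OF that] i2[of b] by (simp add: D_def[abs_def])
  have "(\<integral>x. q0 (\<rho> x) * laplacian \<phi> x \<partial>lborel) = (\<Sum>b\<in>Basis. \<integral>x. q0 (\<rho> x) * partial b (partial b \<phi>) x \<partial>lborel)"
    using i1 by (simp add: laplacian_eq sum_distrib_left integral_sum)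
  also have "\<dots> = (\<integral>x. (\<Sum>b\<in>Basis. w'' b x * \<phi> x) \<partial>lborel)"
    using eq i2 by (simp add: integral_sum)
  also have "\<dots> = (\<integral>x. (\<rho> x ^ 4 * q2 (\<rho> x) + (3 - real DIM('a)) * \<rho> x ^ 3 * q1 (\<rho> x)) * \<phi> x \<partial>lborel)"
  proof (intro Bochner_Integration.integral_cong refl)
    fix x
    show "(\<Sum>b\<in>Basis. w'' b x * \<phi> x) =
      (\<rho> x ^ 4 * q2 (\<rho> x) + (3 - real DIM('a)) * \<rho> x ^ 3 * q1 (\<rho> x)) * \<phi> x"
    proof (cases "x = 0")
      case False
      have nx: "\<rho> x ^ 2 * (\<Sum>b\<in>Basis. (x \<bullet> b)\<^sup>2) = 1"
      proof -
        have "(\<Sum>b\<in>Basis. (x \<bullet> b)\<^sup>2) = norm x ^ 2"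
          unfolding power2_norm_eq_inner by (subst euclidean_inner) (simp add: power2_eq_square)
        then show ?thesis using False by (simp add: \<rho>_def power_inverse)
      qed
      define A where "A = \<rho> x ^ 4 * q2 (\<rho> x) + 3 * \<rho> x ^ 3 * q1 (\<rho> x)"
      have "w'' b x = A * \<rho> x ^ 2 * (x \<bullet> b)\<^sup>2 - \<rho> x ^ 3 * q1 (\<rho> x) * (b \<bullet> b)" for b
        unfolding w''_def A_def by algebra
      then have "(\<Sum>b\<in>Basis. w'' b x) =
          A * \<rho> x ^ 2 * (\<Sum>b\<in>Basis. (x \<bullet> b)\<^sup>2) - DIM('a) * (\<rho> x ^ 3 * q1 (\<rho> x))"
        by (simp add: sum_subtractf sum_distrib_left)
      also have "\<dots> = A * (\<rho> x ^ 2 * (\<Sum>b\<in>Basis. (x \<bullet> b)\<^sup>2)) - DIM('a) * (\<rho> x ^ 3 * q1 (\<rho> x))"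
        by (simp only: mult.assoc)
      also have "\<dots> = \<rho> x ^ 4 * q2 (\<rho> x) + (3 - real DIM('a)) * \<rho> x ^ 3 * q1 (\<rho> x)"
        unfolding nx A_def by (simp add: algebra_simps)
      finally show ?thesis by (simp add: sum_distrib_right[symmetric])
    qed (use S(3) S0 in simp)
  qed
  finally show ?thesis .
qed

lemma test_functions_iterated_laplacian:
  "\<phi> \<in> test_functions \<Omega> \<Longrightarrow> (laplacian ^^ k) \<phi> \<in> test_functions \<Omega>"
  by (induction k) (auto intro: test_functions_laplacian)

text \<open>Here \<open>G (Suc i)\<close> is the derivative of \<open>G i\<close>. With $n$ the dimension, the product rule gives
  \[ \Delta (\rho^a G_i(\rho)) = \rho^{a+4} G_{i+2} + (2a+3-n) \rho^{a+3} G_{i+1}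
       + a(a+2-n) \rho^{a+2} G_i . \]
  For $a > n$ the coefficients are non-negative and the three summands are of the same form as the
  function that is differentiated. Hence an induction can move one Laplacian after the other from
  the test function to the radial function and keep only the leading summand each time. The factor
  $\rho^a$ is there to make the coefficient $3-n$ of Green's formula harmless.\<close>

lemma radial_iterated_laplacian:
  fixes G :: "nat \<Rightarrow> real \<Rightarrow> real" and \<phi> \<rho> :: "'a::euclidean_space \<Rightarrow> real"
  defines "\<rho> \<equiv> \<lambda>x. inverse (norm x)"
  assumes dG: "\<And>i t. i < M \<Longrightarrow> 0 < t \<Longrightarrow> (G i has_real_derivative G (Suc i) t) (at t)"
    and GM: "continuous_on {0<..} (G M)"
    and nonneg: "\<And>i t. i \<le> M \<Longrightarrow> 0 < t \<Longrightarrow> 0 \<le> G i t"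
    and \<phi>: "\<phi> \<in> test_functions \<Omega>" "0 \<notin> \<Omega>" "\<And>x. 0 \<le> \<phi> x"
  shows "i + 2 * k \<le> M \<Longrightarrow> DIM('a) < a \<Longrightarrow>
    (\<integral>x. \<rho> x ^ (a + 4 * k) * G (i + 2 * k) (\<rho> x) * \<phi> x \<partial>lborel) \<le>
    (\<integral>x. \<rho> x ^ a * G i (\<rho> x) * (laplacian ^^ k) \<phi> x \<partial>lborel)"
proof (induction k arbitrary: i a)
  case (Suc k)
  define n where "n = DIM('a)"
  have G_cont: "continuous_on {0<..} (G j)" if "j \<le> M" for j
  proof (cases "j = M")
    case False
    then have "\<And>t. 0 < t \<Longrightarrow> (G j has_real_derivative G (Suc j) t) (at t within {0<..})"
      using dG[of j] that False by (metis has_field_derivative_at_within le_neq_implies_less)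
    then have "\<And>t. t \<in> {0<..} \<Longrightarrow> (G j has_real_derivative G (Suc j) t) (at t within {0<..})" by simp
    then show ?thesis by (rule DERIV_continuous_on)
  qed (use GM in simp)
  have \<rho>_cont: "continuous_on (- {0}) \<rho>" unfolding \<rho>_def by (intro continuous_intros) auto
  have cont: "continuous_on (- {0}) (\<lambda>x. \<rho> x ^ c * G j (\<rho> x))" if "j \<le> M" for c j
  proof -
    have "continuous_on (- {0}) (\<lambda>x. G j (\<rho> x))"
      by (rule continuous_on_compose2[OF G_cont[OF that] \<rho>_cont]) (auto simp: \<rho>_def)
    then show ?thesis by (intro continuous_intros \<rho>_cont)
  qed
  define \<psi> where "\<psi> = (laplacian ^^ k) \<phi>"
  have \<psi>: "\<psi> \<in> test_functions \<Omega>" unfolding \<psi>_def by (rule test_functions_iterated_laplacian[OF \<phi>(1)])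
  define I where "I c j = (\<integral>x. \<rho> x ^ c * G j (\<rho> x) * \<psi> x \<partial>lborel)" for c j
  have int: "integrable lborel (\<lambda>x. \<rho> x ^ c * G j (\<rho> x) * \<psi> x)" if "j \<le> M" for c j
    by (rule test_function_product(2)[OF cont[OF that] \<psi> \<phi>(2)])
  have I_ge: "(\<integral>x. \<rho> x ^ (c + 4 * k) * G (j + 2 * k) (\<rho> x) * \<phi> x \<partial>lborel) \<le> I c j"
    if "j \<le> i + 2" "n < c" for c j
    unfolding I_def \<psi>_def using Suc.IH[of j c] Suc.prems that by (simp add: n_def)
  have I_nonneg: "0 \<le> I c j" if "j \<le> i + 2" "n < c" for c j
  proof -
    have "0 \<le> \<rho> x ^ (c + 4 * k) * G (j + 2 * k) (\<rho> x) * \<phi> x" for x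
    proof (cases "x = 0")
      case False
      then show ?thesis using nonneg[of "j + 2 * k" "\<rho> x"] \<phi>(3) that Suc.prems
        by (intro mult_nonneg_nonneg) (auto simp: \<rho>_def)
    qed (use that in \<open>simp add: \<rho>_def power_0_left\<close>)
    then show ?thesis using I_ge[OF that] by (meson Bochner_Integration.integral_nonneg order_trans)
  qed
  \<comment> \<open>This form of the exponent makes $\rho^a$ differentiable twice without subtraction of naturals.\<close>
  obtain b where b: "a = Suc (Suc b)" "n < Suc (Suc b)"
    using Suc.prems DIM_positive[where 'a='a] unfolding n_def by (cases a; cases "a - 1") auto
  define q1 where "q1 t = real a * t ^ Suc b * G i t + t ^ a * G (Suc i) t" for t :: real
  define q2 where "q2 t = real a * (real (Suc b) * t ^ b * G i t + t ^ Suc b * G (Suc i) t)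
      + (real a * t ^ Suc b * G (Suc i) t + t ^ a * G (Suc (Suc i)) t)" for t :: real
  have "(\<integral>x. \<rho> x ^ a * G i (\<rho> x) * laplacian \<psi> x \<partial>lborel) =
      (\<integral>x. (\<rho> x ^ 4 * q2 (\<rho> x) + (3 - real DIM('a)) * \<rho> x ^ 3 * q1 (\<rho> x)) * \<psi> x \<partial>lborel)"
    unfolding \<rho>_def
  proof (rule radial_Green[OF _ _ _ \<psi> \<phi>(2)])
    fix t :: real assume t: "0 < t"
    have d: "(G i has_real_derivative G (Suc i) t) (at t)" "(G (Suc i) has_real_derivative G (Suc (Suc i)) t) (at t)"
      using dG t Suc.prems by auto
    show "((\<lambda>t. t ^ a * G i t) has_real_derivative q1 t) (at t)"
      unfolding q1_def b by (rule derivative_eq_intros d refl | simp)+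
    show "(q1 has_real_derivative q2 t) (at t)"
      unfolding q1_def q2_def b by (rule derivative_eq_intros d refl | simp add: algebra_simps)+
  next
    show "continuous_on {0<..} q2"
      unfolding q2_def using Suc.prems by (intro continuous_intros G_cont) auto
  qed
  also have "\<dots> = (\<integral>x. \<rho> x ^ (a + 4) * G (i + 2) (\<rho> x) * \<psi> x
      + ((2 * real a + 3 - real n) * (\<rho> x ^ (a + 3) * G (i + 1) (\<rho> x) * \<psi> x)
      + (real a * (real a + 2 - real n)) * (\<rho> x ^ (a + 2) * G i (\<rho> x) * \<psi> x)) \<partial>lborel)"
    unfolding q1_def q2_def b n_def
    by (intro Bochner_Integration.integral_cong refl) (simp add: eval_nat_numeral algebra_simps)
  also have "\<dots> = I (a + 4) (i + 2) + ((2 * real a + 3 - real n) * I (a + 3) (i + 1)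
      + (real a * (real a + 2 - real n)) * I (a + 2) i)"
  proof -
    have split: "(\<integral>x. P x + (c * Q x + d * R x) \<partial>lborel)
        = integral\<^sup>L lborel P + (c * integral\<^sup>L lborel Q + d * integral\<^sup>L lborel R)"
      if "integrable lborel P" "integrable lborel Q" "integrable lborel R"
      for c d :: real and P Q R :: "'a \<Rightarrow> real"
      using that by simp
    then show ?thesis unfolding I_def using Suc.prems by (intro split int) auto
  qed
  finally have "(\<integral>x. \<rho> x ^ a * G i (\<rho> x) * (laplacian ^^ Suc k) \<phi> x \<partial>lborel) = \<dots>"
    by (simp add: \<psi>_def)
  moreover have "0 \<le> (2 * real a + 3 - real n) * I (a + 3) (i + 1)"
    "0 \<le> (real a * (real a + 2 - real n)) * I (a + 2) i"
    using I_nonneg Suc.prems by (auto intro!: mult_nonneg_nonneg simp: n_def)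
  ultimately show ?case
    using I_ge[of "i + 2" "a + 4"] Suc.prems by (simp add: n_def algebra_simps)
qed simp

section \<open>Repeated primitives\<close>

definition primitive :: "(real \<Rightarrow> real) \<Rightarrow> real \<Rightarrow> real" where
  "primitive v t = integral {0..t} v"

lemma primitive_has_derivative:
  assumes "continuous_on {0..} v" "0 < t"
  shows "(primitive v has_real_derivative v t) (at t)"
proof -
  have "continuous_on {0..t+1} v" using assms(1) by (rule continuous_on_subset) auto
  then have "((\<lambda>x. integral {0..x} v) has_real_derivative v t) (at t within {0..t+1})"
    by (rule integral_has_real_derivative) (use assms in auto)
  then have "((\<lambda>x. integral {0..x} v) has_real_derivative v t) (at t)"
    using assms(2) by (subst (asm) at_within_Icc_at) auto
  moreover have "primitive v = (\<lambda>x. integral {0..x} v)" by (auto simp: primitive_def)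
  ultimately show ?thesis by simp
qed

lemma primitive_continuous:
  assumes "\<And>T. v integrable_on {0..T}"
  shows "continuous_on {0..} (primitive v)"
proof -
  have "continuous (at t within {0..}) (primitive v)" if "t \<ge> 0" for t
  proof -
    have c: "continuous_on {0..t+1} (\<lambda>x. integral {0..x} v)"
      by (rule indefinite_integral_continuous_1[OF assms])
    have "continuous (at t within {0..t+1}) (primitive v)"
      using c that by (auto simp: continuous_on_eq_continuous_within primitive_def[abs_def])
    moreover have "at t within {0..t+1} = at t within {0..}"
      by (rule at_within_nhd[of _ "{..<t+1}"]) auto
    ultimately show ?thesis by simp
  qed
  then show ?thesis
    by (simp add: continuous_on_eq_continuous_within)
qed

lemma continuous_imp_integrable_Icc0:
  assumes "continuous_on {0::real..} (v :: real \<Rightarrow> real)"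
  shows "v integrable_on {0..T}"
  by (rule integrable_continuous_real, rule continuous_on_subset[OF assms]) auto

lemma iterated_primitive_continuous:
  assumes "continuous_on {0..} v"
  shows "continuous_on {0..} ((primitive ^^ j) v)"
  by (induction j) (use assms in \<open>auto intro!: primitive_continuous continuous_imp_integrable_Icc0\<close>)

lemma primitive_le:
  assumes "continuous_on {0..} v" "continuous_on {0..} w" "\<And>s. 0 \<le> s \<Longrightarrow> s \<le> t \<Longrightarrow> v s \<le> w s"
  shows "primitive v t \<le> primitive w t"
  unfolding primitive_def
  by (rule integral_le) (use assms in \<open>auto intro: continuous_imp_integrable_Icc0\<close>)

lemma iterated_primitive_le:
  assumes "continuous_on {0..} v" "continuous_on {0..} w" "\<And>s. 0 \<le> s \<Longrightarrow> s \<le> t \<Longrightarrow> v s \<le> w s"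
  shows "0 \<le> s \<Longrightarrow> s \<le> t \<Longrightarrow> (primitive ^^ j) v s \<le> (primitive ^^ j) w s"
proof (induction j arbitrary: s)
  case (Suc j)
  then show ?case
    by (auto intro!: primitive_le iterated_primitive_continuous assms)
qed (use assms in auto)

lemma iterated_primitive_zero: "(primitive ^^ j) (\<lambda>_. 0) = (\<lambda>_. 0)"
  by (induction j) (auto simp: primitive_def)

lemma iterated_primitive_nonneg:
  assumes "continuous_on {0..} v" "\<And>s. 0 \<le> s \<Longrightarrow> 0 \<le> v s" "0 \<le> t"
  shows "0 \<le> (primitive ^^ j) v t"
  using iterated_primitive_le[of "\<lambda>_. 0" v t t j] assms by (simp add: iterated_primitive_zero)

lemma primitive_mono:
  assumes "continuous_on {0..} v" "\<And>s. 0 \<le> s \<Longrightarrow> 0 \<le> v s"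
  shows "mono_on {0..} (primitive v)"
  unfolding primitive_def
  by (intro mono_onI integral_subset_le) (use assms in \<open>auto intro: continuous_imp_integrable_Icc0\<close>)

lemma iterated_primitive_mono:
  assumes "continuous_on {0..} v" "\<And>s. 0 \<le> s \<Longrightarrow> 0 \<le> v s" "mono_on {0..} v"
  shows "mono_on {0..} ((primitive ^^ j) v)"
proof (cases j)
  case (Suc i)
  then show ?thesis
    by (auto intro!: primitive_mono iterated_primitive_nonneg iterated_primitive_continuous assms)
qed (use assms in auto)

lemma primitive_at_0 [simp]: "primitive v 0 = 0"
  by (simp add: primitive_def)

text \<open>Write $y_i$ for the $i$-th primitive of $v$. Since $y_j$ is non-decreasing, the derivative
  $2 y_{j+1} y_j$ of $y_{j+1}^2$ on $[0,t]$ is at most $2 y_j(t)$ times the derivative $y_{j+1}$ of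
  $y_{j+2}$.\<close>

lemma iterated_primitive_square_le:
  assumes v: "continuous_on {0..} v" "\<And>s. 0 \<le> s \<Longrightarrow> 0 \<le> v s" "mono_on {0..} v" and "0 \<le> t"
  shows "((primitive ^^ Suc j) v t)\<^sup>2 \<le> 2 * (primitive ^^ j) v t * (primitive ^^ Suc (Suc j)) v t"
proof (cases "t = 0")
  case False
  then have "t > 0" using assms by simp
  define y where "y i = (primitive ^^ i) v" for i
  have c: "continuous_on {0..} (y i)" for i unfolding y_def by (rule iterated_primitive_continuous[OF v(1)])
  have nn: "0 \<le> y i s" if "0 \<le> s" for i s unfolding y_def using iterated_primitive_nonneg v that by blast
  have S: "y (Suc i) = primitive (y i)" for i by (simp add: y_def)
  have d: "(y (Suc i) has_real_derivative y i s) (at s)" if "0 < s" for i s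
    unfolding S by (rule primitive_has_derivative[OF c that])
  define F where "F s = 2 * y j t * y (Suc (Suc j)) s - (y (Suc j) s)\<^sup>2" for s
  have "F 0 \<le> F t"
  proof (rule DERIV_nonneg_imp_increasing_open[of 0 t F])
    show "0 \<le> t" by fact
    show "continuous_on {0..t} F" unfolding F_def
      by (intro continuous_intros continuous_on_subset[OF c]) auto
    fix s assume s: "0 < s" "s < t"
    have "(F has_real_derivative 2 * y j t * y (Suc j) s - 2 * y (Suc j) s * y j s) (at s)"
      unfolding F_def by (rule derivative_eq_intros d s refl | simp)+
    moreover have "y j s \<le> y j t"
      using iterated_primitive_mono[OF v, of j] s unfolding y_def by (auto simp: mono_on_def)
    then have "0 \<le> 2 * y j t * y (Suc j) s - 2 * y (Suc j) s * y j s"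
      using nn[of s "Suc j"] s mult_left_mono[of "y j s" "y j t" "y (Suc j) s"] by (simp add: algebra_simps)
    ultimately show "\<exists>l. (F has_real_derivative l) (at s) \<and> 0 \<le> l" by blast
  qed
  moreover have "F 0 = 0" by (simp add: F_def S)
  ultimately show ?thesis by (simp add: F_def y_def)
qed simp

text \<open>The preceding inequality says that the ratios $y_j / y_{j+1}$ at most double from one index to the
  next, so that $(y_j / y_{j+1})^{j+1}$ is bounded by a multiple of the telescoping product
  $y_0 / y_{j+1}$. For $w = 1 + y_m$ this bounds $w'$ by a multiple of $(w^{(m)})^{1/m} w^{1-1/m}$.\<close>

lemma iterated_primitive_interpolation:
  assumes v: "continuous_on {0..} v" "\<And>s. 0 \<le> s \<Longrightarrow> 0 \<le> v s" "mono_on {0..} v" and "0 \<le> t"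
  shows "((primitive ^^ j) v t) ^ Suc j \<le> 2 ^ (j * Suc j) * v t * ((primitive ^^ Suc j) v t) ^ j"
proof (induction j)
  case (Suc j)
  define a b c where "a = (primitive ^^ j) v t" and "b = (primitive ^^ Suc j) v t"
    and "c = (primitive ^^ Suc (Suc j)) v t"
  have nn: "0 \<le> a" "0 \<le> b" "0 \<le> c" "0 \<le> v t"
    unfolding a_def b_def c_def using v(2) assms(4)
    by (blast intro: iterated_primitive_nonneg[OF v(1,2)])+
  have IH: "a ^ Suc j \<le> 2 ^ (j * Suc j) * v t * b ^ j"
    using Suc.IH by (simp only: a_def b_def)
  have sq: "b\<^sup>2 \<le> 2 * a * c"
    using iterated_primitive_square_le[OF v assms(4), of j] by (simp only: a_def b_def c_def)
  have "b ^ Suc (Suc j) \<le> 2 ^ (Suc j * Suc (Suc j)) * v t * c ^ Suc j"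
  proof (cases "b = 0")
    case False
    have "b ^ j * b ^ Suc (Suc j) = (b\<^sup>2) ^ Suc j"
      unfolding power_add[symmetric] power_mult[symmetric] by (rule arg_cong[of _ _ "power b"]) simp
    also have "\<dots> \<le> (2 * a * c) ^ Suc j" using sq by (rule power_mono) simp
    also have "\<dots> = (2 * c) ^ Suc j * a ^ Suc j" by (simp add: power_mult_distrib mult_ac)
    also have "\<dots> \<le> (2 * c) ^ Suc j * (2 ^ (j * Suc j) * v t * b ^ j)"
      using IH nn by (intro mult_left_mono) auto
    also have "\<dots> = b ^ j * (2 ^ (Suc j + j * Suc j) * v t * c ^ Suc j)"
      by (simp add: power_mult_distrib power_add mult_ac)
    also have "\<dots> \<le> b ^ j * (2 ^ (Suc j * Suc (Suc j)) * v t * c ^ Suc j)"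
      using nn by (intro mult_left_mono mult_right_mono power_increasing) auto
    finally show ?thesis using False nn by (subst (asm) mult_le_cancel_left_pos) auto
  qed (use nn in auto)
  then show ?case by (simp only: b_def c_def)
qed simp

section \<open>A global solution of the one-dimensional equation\<close>

lemma unbounded_primitive:
  fixes \<psi> :: "real \<Rightarrow> real"
  assumes cont: "continuous_on UNIV \<psi>" and nn: "\<And>x. 0 \<le> \<psi> x"
    and inf: "(\<integral>\<^sup>+x\<in>{1..}. ennreal (\<psi> x) \<partial>lborel) = \<infinity>"
  shows "\<exists>Y\<ge>1. B < primitive \<psi> Y"
proof (rule ccontr)
  assume "\<not> ?thesis"
  then have bnd: "primitive \<psi> Y \<le> B" if "1 \<le> Y" for Y using that by (auto simp: not_less)
  have c: "continuous_on {0..} \<psi>" by (rule continuous_on_subset[OF cont]) auto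
  have m: "mono (primitive \<psi>)"
    unfolding primitive_def
    by (intro monoI integral_subset_le) (use nn in \<open>auto intro: continuous_imp_integrable_Icc0[OF c]\<close>)
  have "incseq (\<lambda>n. primitive \<psi> (real n))" by (intro incseq_SucI monoD[OF m]) simp
  moreover have "primitive \<psi> (real n) \<le> B" for n
    using monoD[OF m, of "real n" "max 1 (real n)"] bnd[of "max 1 (real n)"] by simp
  ultimately obtain l where "(\<lambda>n. primitive \<psi> (real n)) \<longlonglongrightarrow> l"
    using incseq_convergent by blast
  then have lim: "(primitive \<psi> \<longlongrightarrow> l) at_top"
    using m by (intro tendsto_at_topI_sequentially_real)
  have "(\<integral>\<^sup>+x\<in>{1..}. ennreal (\<psi> x) \<partial>lborel) = l - primitive \<psi> 1"
    by (rule nn_integral_FTC_atLeast[OF borel_measurable_continuous_onI[OF cont] _ _ lim])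
      (use primitive_has_derivative[OF c] nn in auto)
  then show False using inf by simp
qed

text \<open>The only place where the divergence of the integral enters. Let $w = 1 + y_m$ be the function
  with $w^{(m)} = v \le H(t) g(t^N w)$. On $[0,T]$ the factor $t^N$ is at most $A = T^N$, and by
  interpolation $(w')^m$ is at most a constant times $g(Aw) w^{m-1}$. This says that
  $\Psi(Aw)$ has bounded slope, where $\Psi$ is the primitive of $g^{-1/m} \zeta^{1/m-1}$. As $\Psi$
  is unbounded, $w(T)$ is bounded, uniformly in $v$.\<close>

lemma iteration_bound:
  fixes H g :: "real \<Rightarrow> real"
  assumes H: "mono_on {0..} H" "\<And>t. 0 < H t"
    and g: "continuous_on UNIV g" "mono g" "\<And>y. 0 < g y"
    and inf: "(\<integral>\<^sup>+\<zeta>\<in>{1..}. ennreal (g \<zeta> powr (- 1 / real m) * \<zeta> powr (1 / real m - 1)) \<partial>lborel) = \<infinity>"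
    and "0 < m" "1 \<le> T"
  obtains Y where "\<And>v. continuous_on {0..} v \<Longrightarrow> (\<And>s. 0 \<le> s \<Longrightarrow> 0 \<le> v s) \<Longrightarrow> mono_on {0..} v \<Longrightarrow>
      (\<And>t. 0 \<le> t \<Longrightarrow> v t \<le> H t * g (t ^ N * (1 + (primitive ^^ m) v t))) \<Longrightarrow>
      1 + (primitive ^^ m) v T \<le> Y"
proof -
  obtain k where m: "m = Suc k" using \<open>0 < m\<close> gr0_conv_Suc by blast
  \<comment> \<open>Only $\zeta \ge 1$ matters. The cut-off makes the integrand continuous on the whole line.\<close>
  define \<psi> where "\<psi> \<zeta> = g \<zeta> powr (- 1 / real m) * max 1 \<zeta> powr (1 / real m - 1)" for \<zeta>
  have \<psi>_cont: "continuous_on UNIV \<psi>"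
    unfolding \<psi>_def using g(3) by (intro continuous_intros g(1)) (auto simp: less_imp_neq[symmetric] max_def)
  have \<psi>_cont0: "continuous_on {0..} \<psi>" by (rule continuous_on_subset[OF \<psi>_cont]) auto
  have \<psi>_nn: "0 \<le> \<psi> x" for x by (simp add: \<psi>_def)
  have "(\<integral>\<^sup>+x\<in>{1..}. ennreal (\<psi> x) \<partial>lborel) = \<infinity>"
    using inf by (rule trans[rotated]) (auto intro!: nn_integral_cong simp: \<psi>_def indicator_def)
  note \<psi>_inf = unbounded_primitive[OF \<psi>_cont \<psi>_nn this]
  have \<psi>_pow: "\<psi> \<zeta> ^ m * (g \<zeta> * \<zeta> ^ k) = 1" if "1 \<le> \<zeta>" for \<zeta>
  proof -
    have "\<psi> \<zeta> ^ m = g \<zeta> powr (-1) * \<zeta> powr (1 - real m)"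
      using that \<open>0 < m\<close> g(3)[of \<zeta>]
      by (simp add: \<psi>_def power_mult_distrib powr_realpow[symmetric] powr_powr algebra_simps)
    also have "\<zeta> powr (1 - real m) = 1 / \<zeta> ^ k"
      using that by (simp add: m powr_minus powr_realpow divide_simps)
    also have "g \<zeta> powr (-1) = 1 / g \<zeta>" using g(3)[of \<zeta>] by (simp add: powr_minus_divide)
    finally show ?thesis using that g(3)[of \<zeta>] by simp
  qed
  define A where "A = T ^ N"
  have A: "1 \<le> A" using \<open>1 \<le> T\<close> by (simp add: A_def)
  \<comment> \<open>The $m$-th power of the slope will be at most $2^{k(k+1)} H(T) A$. Since $L \ge 1$, it is then
    at most $L \le L^m$, which avoids taking a root.\<close>
  define L where "L = max 1 (2 ^ (k * Suc k) * H T * A)"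
  obtain Y where Y: "1 \<le> Y" "primitive \<psi> A + L * T < primitive \<psi> Y" using \<psi>_inf by blast
  show thesis
  proof (rule that[of Y])
    fix v assume v: "continuous_on {0..} v" and v_nn: "\<And>s. 0 \<le> s \<Longrightarrow> 0 \<le> v s"
      and v_mono: "mono_on {0..} v"
      and v_le: "\<And>t. 0 \<le> t \<Longrightarrow> v t \<le> H t * g (t ^ N * (1 + (primitive ^^ m) v t))"
    define w where "w t = 1 + (primitive ^^ m) v t" for t
    define w' where "w' t = (primitive ^^ k) v t" for t
    have w1: "1 \<le> w t" if "0 \<le> t" for t
      unfolding w_def using iterated_primitive_nonneg[OF v v_nn that] by simp
    have w_cont: "continuous_on {0..} w" unfolding w_def
      by (intro continuous_intros iterated_primitive_continuous v)
    have dw: "(w has_real_derivative w' t) (at t)" if "0 < t" for t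
    proof -
      have "(primitive ((primitive ^^ k) v) has_real_derivative w' t) (at t)"
        unfolding w'_def using that by (intro primitive_has_derivative iterated_primitive_continuous v)
      then show ?thesis unfolding w_def m by (auto intro!: derivative_eq_intros)
    qed
    have slope: "\<psi> (A * w t) * (A * w' t) \<le> L" if t: "0 < t" "t < T" for t
    proof -
      have Aw: "1 \<le> A * w t" using mult_mono[of 1 A 1 "w t"] A w1[of t] t by simp
      have "w' t ^ m \<le> 2 ^ (k * Suc k) * v t * (w t - 1) ^ k"
        using iterated_primitive_interpolation[OF v v_nn v_mono, of t k] t
        by (simp add: m w_def w'_def)
      also have "\<dots> \<le> 2 ^ (k * Suc k) * (H T * g (A * w t)) * w t ^ k"
      proof -
        have "v t \<le> H t * g (t ^ N * w t)" using v_le[of t] t by (simp add: w_def)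
        also have "\<dots> \<le> H T * g (A * w t)"
          unfolding A_def using t w1[of t] H(2) g(3)
          by (intro mult_mono mono_onD[OF H(1)] monoD[OF g(2)] power_mono) (auto intro: less_imp_le)
        finally show ?thesis using v_nn[of t] w1[of t] t
          by (intro mult_mono power_mono) (auto intro!: mult_nonneg_nonneg)
      qed
      finally have "w' t ^ m \<le> 2 ^ (k * Suc k) * (H T * g (A * w t)) * w t ^ k" .
      then have "(\<psi> (A * w t) * A) ^ m * w' t ^ m
          \<le> (\<psi> (A * w t) * A) ^ m * (2 ^ (k * Suc k) * (H T * g (A * w t)) * w t ^ k)"
        using A \<psi>_nn by (intro mult_left_mono) auto
      moreover have "(\<psi> (A * w t) * (A * w' t)) ^ m = (\<psi> (A * w t) * A) ^ m * w' t ^ m"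
        by (simp add: power_mult_distrib)
      ultimately have "(\<psi> (A * w t) * (A * w' t)) ^ m
          \<le> (\<psi> (A * w t) * A) ^ m * (2 ^ (k * Suc k) * (H T * g (A * w t)) * w t ^ k)"
        by simp
      also have "\<dots> = (\<psi> (A * w t) ^ m * (g (A * w t) * (A * w t) ^ k)) * (2 ^ (k * Suc k) * H T * A)"
        by (simp add: m power_mult_distrib mult_ac)
      also have "\<dots> \<le> L" using \<psi>_pow[OF Aw] by (simp add: L_def)
      also have "L \<le> L ^ m" by (rule self_le_power) (auto simp: L_def \<open>0 < m\<close>)
      finally have "(\<psi> (A * w t) * (A * w' t)) ^ Suc k \<le> L ^ Suc k" by (simp only: m)
      then show ?thesis by (rule power_le_imp_le_base) (simp add: L_def)
    qed
    define F where "F t = L * t - primitive \<psi> (A * w t)" for t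
    have "F 0 \<le> F T"
    proof (rule DERIV_nonneg_imp_increasing_open[of 0 T F])
      show "continuous_on {0..T} F" unfolding F_def
      proof (intro continuous_on_diff continuous_on_mult continuous_on_const continuous_on_id)
        show "continuous_on {0..T} (\<lambda>t. primitive \<psi> (A * w t))"
        proof (rule continuous_on_compose2[where g = "primitive \<psi>" and f = "\<lambda>t. A * w t" and t = "{0..}"])
          show "continuous_on {0..} (primitive \<psi>)"
            by (intro primitive_continuous continuous_imp_integrable_Icc0 \<psi>_cont0)
          show "continuous_on {0..T} (\<lambda>t. A * w t)"
            by (intro continuous_intros continuous_on_subset[OF w_cont]) auto
          show "(\<lambda>t. A * w t) ` {0..T} \<subseteq> {0..}"
            using A w1 by (fastforce intro: mult_nonneg_nonneg)
        qed
      qed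
      fix t assume t: "0 < t" "t < T"
      have "(F has_real_derivative L - \<psi> (A * w t) * (A * w' t)) (at t)"
      proof -
        have "((\<lambda>t. A * w t) has_real_derivative A * w' t) (at t)"
          by (rule DERIV_cmult[OF dw]) (use t in simp)
        then have "((\<lambda>t. primitive \<psi> (A * w t)) has_real_derivative \<psi> (A * w t) * (A * w' t)) (at t)"
          using t A w1[of t]
          by (intro DERIV_chain2[OF primitive_has_derivative[OF \<psi>_cont0]]) auto
        from DERIV_diff[OF DERIV_cmult[OF DERIV_ident, of L] this] show ?thesis
          unfolding F_def by simp
      qed
      then show "\<exists>y. (F has_real_derivative y) (at t) \<and> 0 \<le> y" using slope[OF t] by force
    qed (use \<open>1 \<le> T\<close> in simp)
    then have "primitive \<psi> (A * w T) \<le> primitive \<psi> A + L * T"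
      by (simp add: F_def w_def m)
    then have "\<not> Y \<le> A * w T"
      using mono_onD[OF primitive_mono[OF \<psi>_cont0 \<psi>_nn], of Y "A * w T"] Y by auto
    moreover have "w T \<le> A * w T" using A w1[of T] \<open>1 \<le> T\<close> mult_right_mono[of 1 A "w T"] by simp
    ultimately show "1 + (primitive ^^ m) v T \<le> Y" by (simp add: w_def)
  qed
qed

text \<open>A pointwise limit of continuous functions can be discontinuous. Its integrability is part of the
  conclusion because it is what makes the first primitive of the limit continuous.\<close>

lemma iterated_primitive_tendsto:
  assumes cont: "\<And>i. continuous_on {0..} (v i)"
    and nonneg: "\<And>i s. 0 \<le> s \<Longrightarrow> 0 \<le> v i s"
    and bound: "\<And>i s T. 0 \<le> s \<Longrightarrow> s \<le> T \<Longrightarrow> v i s \<le> B T"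
    and lim: "\<And>s. 0 \<le> s \<Longrightarrow> (\<lambda>i. v i s) \<longlonglongrightarrow> w s"
  shows "0 \<le> s \<Longrightarrow> (\<lambda>i. (primitive ^^ j) (v i) s) \<longlonglongrightarrow> (primitive ^^ j) w s"
    and "w integrable_on {0..T}"
proof -
  have dom: "(primitive ^^ j) w integrable_on {0..T} \<and>
      (\<lambda>i. primitive ((primitive ^^ j) (v i)) T) \<longlonglongrightarrow> primitive ((primitive ^^ j) w) T"
    if conv: "\<And>s. 0 \<le> s \<Longrightarrow> (\<lambda>i. (primitive ^^ j) (v i) s) \<longlonglongrightarrow> (primitive ^^ j) w s" for j T
  proof -
    have int: "(primitive ^^ j) (v i) integrable_on {0..T}" for i
      by (intro continuous_imp_integrable_Icc0 iterated_primitive_continuous cont)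
    have int_B: "(primitive ^^ j) (\<lambda>_. B T) integrable_on {0..T}"
      by (intro continuous_imp_integrable_Icc0 iterated_primitive_continuous continuous_on_const)
    have le: "norm ((primitive ^^ j) (v i) s) \<le> (primitive ^^ j) (\<lambda>_. B T) s" if "s \<in> {0..T}" for i s
    proof -
      have "0 \<le> (primitive ^^ j) (v i) s"
        by (rule iterated_primitive_nonneg[OF cont nonneg]) (use that in auto)
      moreover have "(primitive ^^ j) (v i) s \<le> (primitive ^^ j) (\<lambda>_. B T) s"
        by (rule iterated_primitive_le[OF cont continuous_on_const bound]) (use that in auto)
      ultimately show ?thesis by simp
    qed
    have lim_j: "(\<lambda>i. (primitive ^^ j) (v i) s) \<longlonglongrightarrow> (primitive ^^ j) w s" if "s \<in> {0..T}" for s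
      using conv that by simp
    show ?thesis
      unfolding primitive_def[of _ T] using dominated_convergence[OF int int_B le lim_j] by blast
  qed
  have conv: "0 \<le> s \<Longrightarrow> (\<lambda>i. (primitive ^^ j) (v i) s) \<longlonglongrightarrow> (primitive ^^ j) w s" for s j
    by (induction j arbitrary: s) (use lim dom in auto)
  then show "0 \<le> s \<Longrightarrow> (\<lambda>i. (primitive ^^ j) (v i) s) \<longlonglongrightarrow> (primitive ^^ j) w s" by blast
  show "w integrable_on {0..T}" using dom[of 0] conv[of _ 0] by simp
qed

text \<open>Successive approximations for $G^{(m)} = H(t) g(t^N G)$ with $G(0) = 1$ and vanishing higher
  initial derivatives. As the right-hand side is non-decreasing in $G$, they increase with the index.
  Therefore each of them after the first satisfies the differential inequality of the a priori bound, which makes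
  them locally bounded. Monotonicity thus takes the place of a Lipschitz condition or of
  compactness.\<close>

lemma global_solution:
  fixes H g :: "real \<Rightarrow> real"
  assumes H: "continuous_on UNIV H" "mono H" "\<And>t. 0 < H t"
    and g: "continuous_on UNIV g" "mono g" "\<And>y. 0 < g y"
    and inf: "(\<integral>\<^sup>+\<zeta>\<in>{1..}. ennreal (g \<zeta> powr (- 1 / real m) * \<zeta> powr (1 / real m - 1)) \<partial>lborel) = \<infinity>"
    and "0 < m"
  shows "\<exists>G. continuous_on {0..} G \<and> (\<forall>t\<ge>0. 1 \<le> G t) \<and>
    (\<forall>t\<ge>0. G t = 1 + (primitive ^^ m) (\<lambda>s. H s * g (s ^ N * G s)) t)"
proof -
  define \<Phi> where "\<Phi> y = (\<lambda>s. H s * g (s ^ N * y s))" for y :: "real \<Rightarrow> real"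
  define y where "y i = ((\<lambda>z t. 1 + (primitive ^^ m) (\<Phi> z) t) ^^ i) (\<lambda>_. 1)" for i
  have y0: "y 0 = (\<lambda>_. 1)" and yS: "y (Suc i) = (\<lambda>t. 1 + (primitive ^^ m) (\<Phi> (y i)) t)" for i
    by (simp_all add: y_def)
  have \<Phi>_cont: "continuous_on {0..} (\<Phi> z)" if "continuous_on {0..} z" for z
    unfolding \<Phi>_def
    by (intro continuous_intros that continuous_on_subset[OF H(1)] continuous_on_compose2[OF g(1)]) auto
  have \<Phi>_nn: "0 \<le> \<Phi> z t" for z t
    unfolding \<Phi>_def using H(3)[of t] g(3)[of "t ^ N * z t"] by simp
  have \<Phi>_le: "\<Phi> z s \<le> \<Phi> z' t" if "0 \<le> s" "s \<le> t" "0 \<le> z s" "z s \<le> z' t" for z z' s t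
    unfolding \<Phi>_def using that H(3) g(3)
    by (intro mult_mono monoD[OF H(2)] monoD[OF g(2)] power_mono) (auto intro: less_imp_le)
  have \<Phi>_mono: "mono_on {0..} (\<Phi> z)" if "mono_on {0..} z" "\<And>t. 0 \<le> t \<Longrightarrow> 1 \<le> z t" for z
  proof (rule mono_onI)
    fix r s :: real assume rs: "r \<in> {0..}" "s \<in> {0..}" "r \<le> s"
    then have "1 \<le> z r" "z r \<le> z s" using that by (auto simp: mono_on_def)
    then show "\<Phi> z r \<le> \<Phi> z s" using rs by (intro \<Phi>_le) auto
  qed
  have y: "continuous_on {0..} (y i) \<and> mono_on {0..} (y i) \<and> (\<forall>t\<ge>0. 1 \<le> y i t)" for i
  proof (induction i)
    case (Suc i)
    have "mono_on {0..} (\<Phi> (y i))" using Suc by (intro \<Phi>_mono) auto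
    then have "mono_on {0..} ((primitive ^^ m) (\<Phi> (y i)))"
      using Suc by (intro iterated_primitive_mono \<Phi>_cont \<Phi>_nn) auto
    then show ?case
      using Suc iterated_primitive_nonneg[OF \<Phi>_cont \<Phi>_nn, of "y i"]
      by (auto simp: yS mono_on_def intro!: continuous_intros iterated_primitive_continuous \<Phi>_cont)
  qed (auto simp: y0 mono_on_def)
  then have y_cont: "continuous_on {0..} (y i)" and y_mono: "mono_on {0..} (y i)"
    and y1: "0 \<le> t \<Longrightarrow> 1 \<le> y i t" for i t by blast+
  have v_mono: "mono_on {0..} (\<Phi> (y i))" for i by (intro \<Phi>_mono y_mono y1)
  have y_incr: "0 \<le> t \<Longrightarrow> y i t \<le> y (Suc i) t" for i t
  proof (induction i arbitrary: t)
    case 0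
    then show ?case using y1[of t "Suc 0"] by (simp add: y0)
  next
    case (Suc i)
    have "(primitive ^^ m) (\<Phi> (y i)) t \<le> (primitive ^^ m) (\<Phi> (y (Suc i))) t"
    proof (rule iterated_primitive_le[OF \<Phi>_cont[OF y_cont] \<Phi>_cont[OF y_cont], of t])
      show "\<Phi> (y i) s \<le> \<Phi> (y (Suc i)) s" if "0 \<le> s" for s
        using that Suc.IH[OF that] y1[of s i] by (intro \<Phi>_le) auto
    qed (use Suc.prems in auto)
    then show ?case by (simp add: yS)
  qed
  have "\<exists>Y. \<forall>i. y i T \<le> Y" if "1 \<le> T" for T
  proof -
    show ?thesis
    proof (rule iteration_bound[OF mono_on_subset[OF H(2) subset_UNIV] H(3) g inf \<open>0 < m\<close> that])
      fix Y assume Y: "\<And>v. continuous_on {0..} v \<Longrightarrow> (\<And>s. 0 \<le> s \<Longrightarrow> 0 \<le> v s) \<Longrightarrow> mono_on {0..} v \<Longrightarrow>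
        (\<And>t. 0 \<le> t \<Longrightarrow> v t \<le> H t * g (t ^ N * (1 + (primitive ^^ m) v t))) \<Longrightarrow>
        1 + (primitive ^^ m) v T \<le> Y"
      have "y (Suc i) T \<le> Y" for i
        unfolding yS
      proof (rule Y[OF \<Phi>_cont[OF y_cont] \<Phi>_nn v_mono])
        fix t :: real assume t: "0 \<le> t"
        have "\<Phi> (y i) t \<le> \<Phi> (y (Suc i)) t" using y_incr[OF t, of i] t y1[OF t, of i] by (intro \<Phi>_le) auto
        then show "\<Phi> (y i) t \<le> H t * g (t ^ N * (1 + (primitive ^^ m) (\<Phi> (y i)) t))"
          by (simp add: \<Phi>_def yS)
      qed
      then have "y i T \<le> Y" for i using y_incr[of T i] that by (meson order_trans zero_le_one)
      then show ?thesis by blast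
    qed
  qed
  then obtain Y where Y: "\<And>T i. 1 \<le> T \<Longrightarrow> y i T \<le> Y T" by metis
  define B where "B T = \<Phi> (\<lambda>_. Y (max 1 T)) (max 1 T)" for T
  have y_bound: "y i s \<le> Y (max 1 T)" if "0 \<le> s" "s \<le> T" for i s T
    using Y[of "max 1 T" i] mono_onD[OF y_mono, of s "max 1 T" i] that by force
  have v_bound: "\<Phi> (y i) s \<le> B T" if "0 \<le> s" "s \<le> T" for i s T
    unfolding B_def using that y_bound[OF that, of i] y1[of s i] by (intro \<Phi>_le) auto
  define G where "G t = lim (\<lambda>i. y i t)" for t
  have y_lim: "(\<lambda>i. y i t) \<longlonglongrightarrow> G t" if "0 \<le> t" for t
  proof -
    have "incseq (\<lambda>i. y i t)" by (rule incseq_SucI) (rule y_incr[OF that])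
    then have "convergent (\<lambda>i. y i t)"
      unfolding convergent_def
      by (rule incseq_convergent[of _ "Y (max 1 t)"]) (use y_bound[OF that order_refl] in blast)+
    then show ?thesis by (simp add: G_def convergent_LIMSEQ_iff)
  qed
  have v_lim: "(\<lambda>i. \<Phi> (y i) t) \<longlonglongrightarrow> \<Phi> G t" if "0 \<le> t" for t
  proof -
    have "isCont g (t ^ N * G t)" using g(1) by (simp add: continuous_on_eq_continuous_at)
    then show ?thesis unfolding \<Phi>_def
      by (intro tendsto_intros isCont_tendsto_compose[of _ g] y_lim that)
  qed
  note lims = iterated_primitive_tendsto[of "\<lambda>i. \<Phi> (y i)" B "\<Phi> G", OF \<Phi>_cont[OF y_cont] \<Phi>_nn v_bound v_lim]
  have G_eq: "G t = 1 + (primitive ^^ m) (\<Phi> G) t" if "0 \<le> t" for t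
  proof (rule LIMSEQ_unique)
    show "(\<lambda>i. y (Suc i) t) \<longlonglongrightarrow> G t" using y_lim[OF that] by (rule LIMSEQ_Suc)
    show "(\<lambda>i. y (Suc i) t) \<longlonglongrightarrow> 1 + (primitive ^^ m) (\<Phi> G) t"
      unfolding yS by (intro tendsto_intros lims that)
  qed
  obtain k where m: "m = Suc k" using \<open>0 < m\<close> gr0_conv_Suc by blast
  have "continuous_on {0..} ((primitive ^^ Suc k) (\<Phi> G))"
    unfolding funpow_Suc_right o_def
    by (intro iterated_primitive_continuous primitive_continuous lims)
  then have "continuous_on {0..} (\<lambda>t. 1 + (primitive ^^ m) (\<Phi> G) t)"
    unfolding m by (intro continuous_intros)
  then have "continuous_on {0..} G" using G_eq by (subst continuous_on_cong[OF refl]) auto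
  moreover have "\<forall>t\<ge>0. 1 \<le> G t"
    by (intro allI impI, rule LIMSEQ_le_const[OF y_lim]) (use y1 in auto)
  moreover have "\<forall>t\<ge>0. G t = 1 + (primitive ^^ m) (\<lambda>s. H s * g (s ^ N * G s)) t"
    by (intro allI impI) (rule G_eq[unfolded \<Phi>_def])
  ultimately show ?thesis by (intro exI[of _ G] conjI)
qed

section \<open>The singular solution\<close>

text \<open>The bounds of $f$ on annuli form a sequence. They are turned into a continuous function because
  it becomes a factor of $G^{(m)}$, whose continuity Green's formula requires.\<close>

lemma continuous_mono_majorant:
  fixes C :: "nat \<Rightarrow> real"
  obtains H :: "real \<Rightarrow> real" where "continuous_on UNIV H" "mono H" "\<And>t. 0 < H t" "\<And>t. 0 \<le> t \<Longrightarrow> C (nat \<lceil>t\<rceil>) \<le> H t"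
proof -
  \<comment> \<open>The $i$-th summand rises from $0$ at $i-2$ to its full size at $i-1$, just before $C_i$ is
    first needed. Near any point only finitely many summands are non-zero.\<close>
  define q where "q i t = \<bar>C i\<bar> * min 1 (max 0 (t - real i + 2))" for i t
  define H where "H t = 1 + (\<Sum>i\<le>nat \<lceil>t\<rceil> + 2. q i t)" for t
  have q0: "0 \<le> q i t" for i t by (simp add: q_def)
  have H_eq: "H t = 1 + (\<Sum>i\<le>K + 2. q i t)" if "t \<le> real K" for t K
  proof -
    have "(\<Sum>i\<le>nat \<lceil>t\<rceil> + 2. q i t) = (\<Sum>i\<le>K + 2. q i t)"
    proof (rule sum.mono_neutral_left)
      show "{..nat \<lceil>t\<rceil> + 2} \<subseteq> {..K + 2}" using that by (auto simp: nat_le_iff ceiling_le_iff intro: order_trans)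
      show "\<forall>i\<in>{..K + 2} - {..nat \<lceil>t\<rceil> + 2}. q i t = 0"
        unfolding q_def by (auto simp: not_le) linarith
    qed simp
    then show ?thesis by (simp add: H_def)
  qed
  have "isCont H t" for t
  proof -
    obtain K where K: "t < real K" using reals_Archimedean2 by blast
    have "continuous_on {..<real K} (\<lambda>t. 1 + (\<Sum>i\<le>K + 2. q i t))"
      unfolding q_def by (intro continuous_intros)
    then have "continuous_on {..<real K} H"
      using H_eq by (subst continuous_on_cong[OF refl]) auto
    then show ?thesis using K by (simp add: continuous_on_eq_continuous_at)
  qed
  then have H_cont: "continuous_on UNIV H" by (simp add: continuous_on_eq_continuous_at)
  have H_mono: "mono H"
  proof (rule monoI)
    fix s t :: real assume "s \<le> t"
    obtain K where K: "t < real K" using reals_Archimedean2 by blast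
    have "q i s \<le> q i t" for i unfolding q_def using \<open>s \<le> t\<close> by (intro mult_left_mono) auto
    then show "H s \<le> H t"
      unfolding H_eq[OF less_imp_le[OF K]] H_eq[OF order_trans[OF \<open>s \<le> t\<close> less_imp_le[OF K]]]
      by (intro add_left_mono sum_mono)
  qed
  have H_pos: "0 < H t" for t unfolding H_def by (intro add_pos_nonneg sum_nonneg q0) simp
  have H_ge: "C (nat \<lceil>t\<rceil>) \<le> H t" if "0 \<le> t" for t
  proof -
    have "1 \<le> t - real (nat \<lceil>t\<rceil>) + 2" using that by linarith
    then have "q (nat \<lceil>t\<rceil>) t \<ge> C (nat \<lceil>t\<rceil>)" unfolding q_def by (simp add: min_absorb1)
    moreover have "q (nat \<lceil>t\<rceil>) t \<le> (\<Sum>i\<le>nat \<lceil>t\<rceil> + 2. q i t)"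
      by (rule member_le_sum[of "nat \<lceil>t\<rceil>" _ "\<lambda>i. q i t"]) (auto simp: q0, linarith)
    ultimately show ?thesis by (simp add: H_def)
  qed
  show thesis by (rule that[of H]) (use H_cont H_mono H_pos H_ge in auto)
qed

lemma Lloc_1I:
  fixes w K :: "'a::euclidean_space \<Rightarrow> real"
  assumes w: "w \<in> borel_measurable (lebesgue_on (ball 0 1 - {0}))"
    and K: "continuous_on (- {0}) K"
    and le: "AE x in lebesgue. x \<in> ball 0 1 - {0} \<longrightarrow> \<bar>w x\<bar> \<le> K x"
  shows "w \<in> Lloc_1"
proof -
  have "w absolutely_integrable_on (ball 0 1 - ball 0 r)" if r: "0 < r" "r < 1" for r
  proof -
    let ?A = "ball 0 1 - ball 0 r :: 'a set" and ?B = "cball 0 1 - ball 0 r :: 'a set"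
    have A: "?A \<subseteq> ball 0 1 - {0}" using r by auto
    have "compact ?B" by (simp add: compact_diff)
    moreover have "continuous_on ?B K" by (rule continuous_on_subset[OF K]) (use r in auto)
    ultimately have "integrable lborel (\<lambda>x. indicator ?B x *\<^sub>R K x)" by (rule borel_integrable_compact)
    then have int: "integrable lebesgue (\<lambda>x. indicator ?B x *\<^sub>R K x)"
      by (subst integrable_completion) auto
    have "w \<in> borel_measurable (lebesgue_on ?A)"
      by (rule measurable_restrict_mono[OF w A])
    then have "(\<lambda>x. indicator ?A x *\<^sub>R w x) \<in> borel_measurable lebesgue"
      by (subst (asm) borel_measurable_restrict_space_iff) auto
    then show ?thesis
      unfolding set_integrable_def
      by (rule Bochner_Integration.integrable_bound[OF int])
        (use le in eventually_elim, use r in \<open>auto simp: indicator_def\<close>)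
  qed
  then show ?thesis using w by (auto simp: Lloc_1_def)
qed

text \<open>On the ball of radius $r$, whose volume is $V r^n$, the function is at least $r^{-n-1}$, so that its
  integral would be at least $V/r$ for every $r < 1$.\<close>

lemma inverse_norm_power_not_integrable:
  fixes w :: "'a::euclidean_space \<Rightarrow> real"
  assumes w: "\<And>x. x \<in> ball 0 1 - {0} \<Longrightarrow> inverse (norm x) ^ Suc DIM('a) \<le> w x"
  shows "\<not> w absolutely_integrable_on ball 0 1"
proof
  assume "w absolutely_integrable_on ball 0 1"
  then have int: "integrable lebesgue (\<lambda>x. indicator (ball 0 1) x * w x)"
    by (simp add: set_integrable_def)
  define I where "I = (\<integral>x. indicator (ball 0 1) x * w x \<partial>lebesgue)"
  define V where "V = unit_ball_vol (real DIM('a))"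
  have V: "0 < V" unfolding V_def by simp
  have ne0: "AE x in lebesgue. x \<noteq> (0::'a)" by (rule AE_completion) (rule AE_lborel_singleton)
  have le: "V / r \<le> I" if r: "0 < r" "r < 1" for r
  proof -
    have "integrable lebesgue (\<lambda>x. inverse r ^ Suc DIM('a) * indicator (ball (0::'a) r) x)"
      using emeasure_lborel_ball_finite[of "0::'a" r]
      by (intro integrable_mult_right integrable_real_indicator) (auto simp: emeasure_completion)
    moreover have "AE x in lebesgue. inverse r ^ Suc DIM('a) * indicator (ball (0::'a) r) x \<le> indicator (ball 0 1) x * w x"
      using ne0
    proof eventually_elim
      case (elim x)
      show ?case
      proof (cases "norm x < r")
        case True
        then have "inverse r ^ Suc DIM('a) \<le> inverse (norm x) ^ Suc DIM('a)"
          using elim r by (intro power_mono le_imp_inverse_le) auto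
        also have "\<dots> \<le> w x" using elim True r by (intro w) auto
        finally show ?thesis using True r by simp
      next
        case False
        have "0 \<le> w x" if "norm x < 1"
          using w[of x] that elim by (meson DiffI empty_iff insert_iff mem_ball_0 order_trans zero_le_power inverse_nonnegative_iff_nonnegative norm_ge_zero)
        then show ?thesis using False by (simp add: indicator_def)
      qed
    qed
    ultimately have "(\<integral>x. inverse r ^ Suc DIM('a) * indicator (ball (0::'a) r) x \<partial>lebesgue) \<le> I"
      unfolding I_def by (intro integral_mono_AE int)
    also have "(\<integral>x. inverse r ^ Suc DIM('a) * indicator (ball (0::'a) r) x \<partial>lebesgue)
        = inverse r ^ Suc DIM('a) * (V * r ^ DIM('a))"
      using r by (simp add: V_def content_ball measure_completion)
    also have "\<dots> = V / r" using r by (simp add: field_simps)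
    finally show ?thesis .
  qed
  define r where "r = min (1 / 2) (V / (\<bar>I\<bar> + 1))"
  have r: "0 < r" "r < 1" using V by (auto simp: r_def)
  have "r \<le> V / (\<bar>I\<bar> + 1)" by (simp add: r_def)
  then have "r * (\<bar>I\<bar> + 1) \<le> V" by (simp add: pos_le_divide_eq)
  then have "\<bar>I\<bar> + 1 \<le> V / r" using r by (simp add: field_simps)
  then show False using le[OF r] by simp
qed

lemma set_lebesgue_integral_eq_lborel_integral:
  fixes h :: "'a::euclidean_space \<Rightarrow> real"
  assumes "continuous_on UNIV h" "\<And>x. x \<notin> A \<Longrightarrow> h x = 0"
  shows "(LINT x:A|lebesgue. h x) = integral\<^sup>L lborel h"
proof -
  have "(\<lambda>x. indicator A x *\<^sub>R h x) = h" using assms(2) by (auto simp: indicator_def fun_eq_iff)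
  then show ?thesis
    unfolding set_lebesgue_integral_def
    by (simp add: integral_completion borel_measurable_continuous_onI[OF assms(1)])
qed

text \<open>With $n$ the dimension, the solution is $u = \rho^{n+1} G(\rho)$, where $G$ solves the
  one-dimensional equation with $N = n+1$: its right-hand side at $t = \rho$ is then
  $H(\rho) g(u)$, which dominates $f g(u)$. Since $G \ge 1$, the factor $\rho^{n+1}$ alone makes $u$
  non-integrable.\<close>

lemma exists_nonremovable_solution:
  fixes m :: nat and g :: "real \<Rightarrow> real" and f :: "'a::euclidean_space \<Rightarrow> real"
  assumes m: "m \<ge> 2" "even m"
    and g_pos: "\<And>t. t > 0 \<Longrightarrow> g t > 0"
    and g_mono: "mono_on {0<..} g"
    and g_cont: "continuous_on {0<..} g"
    and g_inf: "(\<integral>\<^sup>+\<zeta>\<in>{1..}. ennreal (g \<zeta> powr (- 1 / real m) * \<zeta> powr (1 / real m - 1)) \<partial>lborel) = \<infinity>"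
    and f: "f \<in> Lloc_infinity"
  shows "\<exists>u. positive_solution m f g u \<and> \<not> removable_singularity m f g u"
proof -
  define \<rho> where "\<rho> x = inverse (norm x)" for x :: 'a
  define N where "N = Suc DIM('a)"
  define k where "k = m div 2"
  have mk: "m = 2 * k" "0 < m" using m by (auto simp: k_def)
  have \<rho>1: "1 < \<rho> x" if "x \<in> ball 0 1 - {0}" for x
    using that unfolding \<rho>_def by (intro one_less_inverse) auto
  have \<rho>_cont: "continuous_on (- {0}) \<rho>" unfolding \<rho>_def by (intro continuous_intros) auto

  \<comment> \<open>The solution will be at least $1$, so that $g$ may be changed below $1$ to be continuous and
    monotone on the whole line.\<close>
  define g1 where "g1 y = g (max 1 y)" for y
  have g1_cont: "continuous_on UNIV g1"
    unfolding g1_def by (intro continuous_on_compose2[OF g_cont] continuous_intros) auto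
  have g1_mono: "mono g1"
    unfolding g1_def by (intro monoI mono_onD[OF g_mono]) auto
  have g1_pos: "0 < g1 y" for y unfolding g1_def by (rule g_pos) simp
  have g1_inf: "(\<integral>\<^sup>+\<zeta>\<in>{1..}. ennreal (g1 \<zeta> powr (- 1 / real m) * \<zeta> powr (1 / real m - 1)) \<partial>lborel) = \<infinity>"
    using g_inf by (rule trans[rotated]) (auto intro!: nn_integral_cong simp: g1_def indicator_def)

  have "\<exists>C. AE x in lebesgue_on (ball 0 1 - ball 0 (1 / (real j + 2))). \<bar>f x\<bar> \<le> C" for j
    using f by (auto simp: Lloc_infinity_def)
  then obtain C where C: "\<And>j. AE x in lebesgue_on (ball 0 1 - ball 0 (1 / (real j + 2))). \<bar>f x\<bar> \<le> C j"
    by metis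
  obtain H :: "real \<Rightarrow> real" where H: "continuous_on UNIV H" "mono H" "\<And>t. 0 < H t"
      "\<And>t. 0 \<le> t \<Longrightarrow> C (nat \<lceil>t\<rceil>) \<le> H t"
    using continuous_mono_majorant[of C] by metis
  have f_le: "AE x in lebesgue. x \<in> ball 0 1 - {0} \<longrightarrow> \<bar>f x\<bar> \<le> H (\<rho> x)"
  proof -
    have "AE x in lebesgue. \<forall>j. x \<in> ball 0 1 - ball 0 (1 / (real j + 2)) \<longrightarrow> \<bar>f x\<bar> \<le> C j"
      unfolding AE_all_countable
    proof
      fix j
      show "AE x in lebesgue. x \<in> ball 0 1 - ball 0 (1 / (real j + 2)) \<longrightarrow> \<bar>f x\<bar> \<le> C j"
        using C[of j] by (subst (asm) AE_restrict_space_iff) auto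
    qed
    then show ?thesis
    proof eventually_elim
      case (elim x)
      show ?case
      proof
        assume x: "x \<in> ball 0 1 - {0}"
        let ?j = "nat \<lceil>\<rho> x\<rceil>"
        have "\<rho> x \<le> real ?j + 2" by linarith
        then have "1 / (real ?j + 2) \<le> norm x"
          using le_imp_inverse_le[of "\<rho> x" "real ?j + 2"] \<rho>1[OF x]
          by (simp only: \<rho>_def inverse_inverse_eq inverse_eq_divide[symmetric])
        then have "\<bar>f x\<bar> \<le> C ?j" using elim x by auto
        also have "\<dots> \<le> H (\<rho> x)" using \<rho>1[OF x] by (intro H) simp
        finally show "\<bar>f x\<bar> \<le> H (\<rho> x)" .
      qed
    qed
  qed

  obtain G0 where "continuous_on {0..} G0 \<and> (\<forall>t\<ge>0. 1 \<le> G0 t) \<and>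
      (\<forall>t\<ge>0. G0 t = 1 + (primitive ^^ m) (\<lambda>s. H s * g1 (s ^ N * G0 s)) t)"
    using global_solution[OF H(1,2,3) g1_cont g1_mono g1_pos g1_inf mk(2), of N] by (rule exE)
  then have G0: "continuous_on {0..} G0" "\<And>t. 0 \<le> t \<Longrightarrow> 1 \<le> G0 t"
    "\<And>t. 0 \<le> t \<Longrightarrow> G0 t = 1 + (primitive ^^ m) (\<lambda>s. H s * g1 (s ^ N * G0 s)) t"
    by blast+
  define v where "v s = H s * g1 (s ^ N * G0 s)" for s
  have v_cont: "continuous_on {0..} v"
    unfolding v_def
    by (intro continuous_on_mult continuous_on_subset[OF H(1)] continuous_on_compose2[OF g1_cont] continuous_on_power
        continuous_on_id G0(1)) auto
  have v_pos: "0 < v s" for s unfolding v_def using H(3) g1_pos by simp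
  \<comment> \<open>The $i$-th derivative of \<open>G0\<close>. The constant of integration is non-zero for $i = 0$ only.\<close>
  define G where "G i t = (if i = 0 then 1 else 0) + (primitive ^^ (m - i)) v t" for i t
  have G_0: "G 0 t = G0 t" if "0 \<le> t" for t using G0(3)[OF that] by (simp add: G_def v_def[abs_def])
  have G_m: "G m = v" using mk by (simp add: G_def fun_eq_iff)
  have dG: "(G i has_real_derivative G (Suc i) t) (at t)" if "i < m" "0 < t" for i t
  proof -
    have "(primitive ((primitive ^^ (m - Suc i)) v) has_real_derivative (primitive ^^ (m - Suc i)) v t) (at t)"
      by (intro primitive_has_derivative iterated_primitive_continuous v_cont that)
    moreover have "m - i = Suc (m - Suc i)" using that by simp
    ultimately have "((primitive ^^ (m - i)) v has_real_derivative G (Suc i) t) (at t)"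
      by (simp add: G_def)
    from DERIV_add[OF DERIV_const this, of "if i = 0 then 1 else 0"] show ?thesis
      unfolding G_def[of i, abs_def] by simp
  qed
  have G_cont: "continuous_on {0..} (G i)" for i
    unfolding G_def by (intro continuous_intros iterated_primitive_continuous v_cont)
  have G_nonneg: "0 \<le> G i t" if "0 < t" for i t
    unfolding G_def using iterated_primitive_nonneg[OF v_cont less_imp_le[OF v_pos], of t "m - i"] that
    by auto

  define u where "u x = \<rho> x ^ N * G 0 (\<rho> x)" for x
  have comp: "continuous_on (- {0}) (\<lambda>x. q (\<rho> x))" if "continuous_on {0..} q" for q :: "real \<Rightarrow> real"
    by (rule continuous_on_compose2[OF that \<rho>_cont]) (auto simp: \<rho>_def)
  have u_cont: "continuous_on (- {0}) u"
    unfolding u_def by (intro continuous_on_mult continuous_on_power \<rho>_cont comp G_cont)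
  have u_ge: "\<rho> x ^ N \<le> u x" if "x \<in> ball 0 1 - {0}" for x
    unfolding u_def using G0(2)[of "\<rho> x"] G_0[of "\<rho> x"] \<rho>1[OF that]
      mult_left_mono[of 1 "G 0 (\<rho> x)" "\<rho> x ^ N"] by simp
  have u1: "1 \<le> u x" if "x \<in> ball 0 1 - {0}" for x
    using u_ge[OF that] one_le_power[OF less_imp_le[OF \<rho>1[OF that]], of N] by linarith
  have gu: "H (\<rho> x) * g (u x) = v (\<rho> x)" if "x \<in> ball 0 1 - {0}" for x
    using u1[OF that] \<rho>1[OF that] G_0[of "\<rho> x"] by (simp add: v_def g1_def max_def u_def)

  have u_meas: "u \<in> borel_measurable (lebesgue_on (ball 0 1 - {0}))"
    by (rule continuous_imp_measurable_on_sets_lebesgue)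
      (auto intro: continuous_on_subset[OF u_cont])
  have gu_meas: "(\<lambda>x. g (u x)) \<in> borel_measurable (lebesgue_on (ball 0 1 - {0}))"
  proof (rule continuous_imp_measurable_on_sets_lebesgue)
    show "continuous_on (ball 0 1 - {0}) (\<lambda>x. g (u x))"
      by (rule continuous_on_compose2[OF g_cont continuous_on_subset[OF u_cont]])
        (use u1 in \<open>fastforce\<close>)+
  qed auto
  have fgu_le: "AE x in lebesgue. x \<in> ball 0 1 - {0} \<longrightarrow> \<bar>f x * g (u x)\<bar> \<le> v (\<rho> x)"
    using f_le
  proof eventually_elim
    case (elim x)
    show ?case
    proof
      assume x: "x \<in> ball 0 1 - {0}"
      have "0 < g (u x)" using u1[OF x] by (intro g_pos) simp
      then have "\<bar>f x * g (u x)\<bar> \<le> H (\<rho> x) * g (u x)"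
        using elim x by (simp add: abs_mult mult_right_mono)
      then show "\<bar>f x * g (u x)\<bar> \<le> v (\<rho> x)" using gu[OF x] by simp
    qed
  qed

  have "weak_inequality (ball 0 1 - {0}) m f g u"
    unfolding weak_inequality_def
  proof (intro ballI impI)
    fix \<phi> :: "'a \<Rightarrow> real"
    assume \<phi>: "\<phi> \<in> test_functions (ball 0 1 - {0})" and \<phi>_nonneg: "\<forall>x. 0 \<le> \<phi> x"
    have 0: "0 \<notin> ball 0 1 - {0::'a}" by simp
    have \<psi>: "(laplacian ^^ k) \<phi> \<in> test_functions (ball 0 1 - {0})"
      by (rule test_functions_iterated_laplacian[OF \<phi>])
    have outside: "\<psi> x = 0" if "\<psi> \<in> test_functions (ball 0 1 - {0})" "x \<notin> ball 0 1 - {0}" for \<psi> x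
      using that by (metis test_functionsE subsetD)
    define R where "R x = \<rho> x ^ (N + 4 * k) * v (\<rho> x) * \<phi> x" for x
    have "continuous_on (- {0}) (\<lambda>x. \<rho> x ^ (N + 4 * k) * v (\<rho> x))"
      by (intro continuous_on_mult continuous_on_power \<rho>_cont comp v_cont)
    then have R: "continuous_on UNIV R" "integrable lborel R"
      using test_function_product[OF _ \<phi> 0] by (simp_all only: R_def[abs_def])
    then have R_int: "integrable lebesgue R" by (subst integrable_completion) auto
    have R_nonneg: "0 \<le> R x" for x
      unfolding R_def using \<phi>_nonneg v_pos[of "\<rho> x"] by (simp add: \<rho>_def)
    have "(LINT x:ball 0 1|lebesgue. f x * g (u x) * \<phi> x) \<le> integral\<^sup>L lebesgue R"
      unfolding set_lebesgue_integral_def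
    proof (rule integral_mono_AE'[OF R_int])
      show "AE x in lebesgue. indicator (ball 0 1) x *\<^sub>R (f x * g (u x) * \<phi> x) \<le> R x"
        using fgu_le
      proof eventually_elim
        case (elim x)
        show ?case
        proof (cases "x \<in> ball 0 1 - {0}")
          case True
          then have "f x * g (u x) \<le> v (\<rho> x)" using elim by auto
          also have "\<dots> \<le> \<rho> x ^ (N + 4 * k) * v (\<rho> x)"
            using \<rho>1[OF True] v_pos[of "\<rho> x"] mult_right_mono[of 1 "\<rho> x ^ (N + 4 * k)" "v (\<rho> x)"]
            by (simp add: one_le_power)
          finally show ?thesis
            using True \<phi>_nonneg by (simp add: R_def mult_right_mono)
        qed (use outside[OF \<phi>] R_nonneg in simp)
      qed
    qed (use R_nonneg in simp)
    also have "\<dots> = integral\<^sup>L lborel R"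
      by (rule integral_completion) (use borel_measurable_continuous_onI[OF R(1)] in simp)
    also have "\<dots> \<le> (\<integral>x. \<rho> x ^ N * G 0 (\<rho> x) * (laplacian ^^ k) \<phi> x \<partial>lborel)"
    proof -
      have "continuous_on {0<..} (G m)" by (rule continuous_on_subset[OF G_cont]) auto
      from radial_iterated_laplacian[of m G \<phi> "ball 0 1 - {0}" 0 k N, OF dG this G_nonneg \<phi> 0] show ?thesis
        using \<phi>_nonneg mk by (simp add: R_def[abs_def] \<rho>_def[abs_def] N_def G_m[symmetric])
    qed
    also have "\<dots> = (LINT x:ball 0 1|lebesgue. u x * (laplacian ^^ k) \<phi> x)"
      unfolding u_def[symmetric]
      by (rule set_lebesgue_integral_eq_lborel_integral[symmetric, OF test_function_product(1)[OF u_cont \<psi> 0]])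
        (use outside[OF \<psi>] in simp)
    finally show "(LINT x:ball 0 1|lebesgue. f x * g (u x) * \<phi> x)
        \<le> (LINT x:ball 0 1|lebesgue. u x * (laplacian ^^ (m div 2)) \<phi> x)"
      by (simp add: k_def)
  qed
  moreover have "u \<in> Lloc_1"
    using u_cont u1 by (intro Lloc_1I[OF u_meas, of u] AE_I2) force+
  moreover have "(\<lambda>x. f x * g (u x)) \<in> Lloc_1"
    using f gu_meas by (intro Lloc_1I[OF _ comp[OF v_cont] fgu_le] borel_measurable_times) (auto simp: Lloc_infinity_def)
  moreover have "0 < u x" if "x \<in> ball 0 1 - {0}" for x using u1[OF that] by simp
  ultimately have "positive_solution m f g u" by (simp add: positive_solution_def)
  moreover have "\<not> u absolutely_integrable_on ball 0 1"
    using u_ge by (intro inverse_norm_power_not_integrable) (simp add: \<rho>_def N_def)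
  then have "\<not> removable_singularity m f g u" by (simp add: removable_singularity_def)
  ultimately show ?thesis by blast
qed

theorem theorem2p1:
  fixes m :: nat and g :: "real \<Rightarrow> real" and f :: "real ^ 'n \<Rightarrow> real"
  assumes "CARD('n) \<ge> 2"
    and "m \<ge> 2" and "even m"
    and "\<And>t. t > 0 \<Longrightarrow> g t > 0"
    and "mono_on {0<..} g"
    and "continuous_on {0<..} g"
    and "(\<integral>\<^sup>+\<zeta>\<in>{1..}. ennreal (g \<zeta> powr (- 1 / real m) * \<zeta> powr (1 / real m - 1)) \<partial>lborel) = \<infinity>"
    and "f \<in> Lloc_infinity"
  shows "\<exists>u. positive_solution m f g u \<and> \<not> removable_singularity m f g u"
  using exists_nonremovable_solution[OF assms(2-8)] .

end
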